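(* Let $G$ be a $\varphi$-uniform domain in $\mathbb{R}^n$. Let $B$ be a ball with $2B\subset G$. Suppose that $E$ is a compact subset of $B$ such that $\mathbb{R}^n\setminus E$ is $\psi$-uniform. Then $G\setminus E$ is $\vartheta$-uniform, where the homeomorphism $\vartheta:[0,\infty)\to[0,\infty)$ depends only on $\varphi$ and $\psi$.
   Context: Throughout $n\ge 2$; a domain is an open connected non-empty subset of $\mathbb{R}^n$. $2B$ denotes the ball with the same center as $B$ and twice its radius. For a domain $G\subsetneq\mathbb{R}^n$ and $x\in G$, $\delta_G(x)$ is the Euclidean distance from $x$ to $\partial G$. The quasihyperbolic metric of $G$ is $k_G(x,y)=\inf_{\gamma}\int_\gamma \frac{|dz|}{\delta_G(z)}$, the infimum being over all rectifiable paths $\gamma\subset G$ joining $x$ and $y$. For a homeomorphism $\varphi:[0,\infty)\to[0,\infty)$, a domain $G\subsetneq\mathbb{R}^n$ is called $\varphi$-uniform if $k_G(x,y)\le \varphi\big(|x-y|/\min\{\delta_G(x),\delta_G(y)\}\big)$ for all $x,y\in G$ (and similarly for homeomorphisms $\psi$, $\vartheta$ of $[0,\infty)$). *)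

theory Defs
  imports "HOL-Analysis.Analysis"
begin

text \<open>
  \<open>\<real>\<^sup>n\<close> is \<^term>\<open>Euclidean_space n\<close>, whose points are the sequences \<open>x :: nat \<Rightarrow> real\<close> with
  \<open>x i = 0\<close> for \<open>i \<ge> n\<close>. The dimension is thus a natural number rather than a type, so that
  one control function can serve all dimensions at once.
\<close>

definition edist :: "nat \<Rightarrow> (nat \<Rightarrow> real) \<Rightarrow> (nat \<Rightarrow> real) \<Rightarrow> real" where
  "edist n x y = L2_set (\<lambda>i. x i - y i) {..<n}"

definition euclid_ball :: "nat \<Rightarrow> (nat \<Rightarrow> real) \<Rightarrow> real \<Rightarrow> (nat \<Rightarrow> real) set" where
  "euclid_ball n z r = {x \<in> topspace (Euclidean_space n). edist n z x < r}"

definition edomain :: "nat \<Rightarrow> (nat \<Rightarrow> real) set \<Rightarrow> bool" where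
  "edomain n G \<longleftrightarrow>
     openin (Euclidean_space n) G \<and> connectedin (Euclidean_space n) G \<and> G \<noteq> {}"

text \<open>Only meaningful when the boundary is nonempty, as it is for a domain \<open>G \<noteq> \<real>\<^sup>n\<close>.\<close>

definition bdry_dist :: "nat \<Rightarrow> (nat \<Rightarrow> real) set \<Rightarrow> (nat \<Rightarrow> real) \<Rightarrow> real" where
  "bdry_dist n G x = (INF y \<in> Euclidean_space n frontier_of G. edist n x y)"

definition polygonal_lengths :: "nat \<Rightarrow> (real \<Rightarrow> nat \<Rightarrow> real) \<Rightarrow> real \<Rightarrow> real \<Rightarrow> real set" where
  "polygonal_lengths n \<gamma> a b =
     {\<Sum>i<m. edist n (\<gamma> (t i)) (\<gamma> (t (Suc i))) | m t.
        mono_on {..m} t \<and> t ` {..m} \<subseteq> {a..b}}"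

definition rectifiable :: "nat \<Rightarrow> (real \<Rightarrow> nat \<Rightarrow> real) \<Rightarrow> bool" where
  "rectifiable n \<gamma> \<longleftrightarrow> bdd_above (polygonal_lengths n \<gamma> 0 1)"

definition curve_length :: "nat \<Rightarrow> (real \<Rightarrow> nat \<Rightarrow> real) \<Rightarrow> real \<Rightarrow> real \<Rightarrow> real" where
  "curve_length n \<gamma> a b = Sup (polygonal_lengths n \<gamma> a b)"

text \<open>
  The parametrization of \<open>\<gamma>\<close> by arc length, on \<open>[0, L]\<close> with \<open>L\<close> the length of \<open>\<gamma>\<close>. The choice
  of \<open>t\<close> is immaterial, because \<open>\<gamma>\<close> is constant between parameters with equal arc length.
\<close>

definition arc_length_param :: "nat \<Rightarrow> (real \<Rightarrow> nat \<Rightarrow> real) \<Rightarrow> real \<Rightarrow> nat \<Rightarrow> real" where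
  "arc_length_param n \<gamma> s = \<gamma> (SOME t. t \<in> {0..1} \<and> curve_length n \<gamma> 0 t = s)"

definition line_integral ::
    "nat \<Rightarrow> ((nat \<Rightarrow> real) \<Rightarrow> real) \<Rightarrow> (real \<Rightarrow> nat \<Rightarrow> real) \<Rightarrow> real" where
  "line_integral n f \<gamma> =
     integral {0..curve_length n \<gamma> 0 1} (\<lambda>s. f (arc_length_param n \<gamma> s))"

definition quasihyperbolic ::
    "nat \<Rightarrow> (nat \<Rightarrow> real) set \<Rightarrow> (nat \<Rightarrow> real) \<Rightarrow> (nat \<Rightarrow> real) \<Rightarrow> real" where
  "quasihyperbolic n G x y =
     Inf {line_integral n (\<lambda>z. 1 / bdry_dist n G z) \<gamma> | \<gamma>.
            pathin (Euclidean_space n) \<gamma> \<and> rectifiable n \<gamma> \<and> \<gamma> ` {0..1} \<subseteq> G \<and>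
            \<gamma> 0 = x \<and> \<gamma> 1 = y}"

text \<open>Self-homeomorphisms of \<open>[0, \<infinity>)\<close>; values at negative arguments are irrelevant.\<close>

definition halfline_homeo :: "(real \<Rightarrow> real) \<Rightarrow> bool" where
  "halfline_homeo \<phi> \<longleftrightarrow> (\<exists>g. homeomorphism {0..} {0..} \<phi> g)"

definition uniform_domain :: "nat \<Rightarrow> (real \<Rightarrow> real) \<Rightarrow> (nat \<Rightarrow> real) set \<Rightarrow> bool" where
  "uniform_domain n \<phi> G \<longleftrightarrow>
     edomain n G \<and> G \<noteq> topspace (Euclidean_space n) \<and>
     (\<forall>x\<in>G. \<forall>y\<in>G.
        quasihyperbolic n G x y \<le> \<phi> (edist n x y / min (bdry_dist n G x) (bdry_dist n G y)))"

end

theory Submission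
  imports Defs
begin

text \<open>
  Up to constants, the quasihyperbolic distance counts the steps of a chain of points in which
  consecutive points are closer than a fixed fraction of their distances to the complement.
  A quasihyperbolic bound gives a chain of bounded length by walking along the arc length
  parametrization, and a chain gives a bound by means of its polygon. Enlarge the ball so that
  its double touches the boundary of \<open>G\<close>. Then outside \<open>13/10 B\<close> the distances to the complements of
  \<open>G\<close> and of \<open>G - E\<close> are comparable, and inside \<open>17/10 B\<close> so are the distances to \<open>E\<close> and to the
  complement of \<open>G - E\<close>. Hence chains of \<open>G\<close> serve outside and chains of the complement of \<open>E\<close>
  serve inside, once their excursions across a sphere around \<open>B\<close> are replaced by arcs of great
  circles in a thin annulus. Two points on different sides of the annulus are joined through a
  point of it. For points that are close relative to the distance to the complement, the segment
  between them gives the linear bound that makes the control function vanish at \<open>0\<close>.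
\<close>

section \<open>Euclidean distance and distance to the complement\<close>

text \<open>Chains can be cut, rerouted and counted by induction on relation powers, with no surgery
  on rectifiable curves. Curves matter only at two interfaces: a hypothesis on
  \<open>quasihyperbolic\<close> has to be exploited through arc length, and the conclusion is
  reached with a Lipschitz path. Both may be wasteful (\<open>N\<close> steps cost
  \<open>8 ^ N\<close>), since only some control function is claimed; but no count may depend on
  \<open>n\<close>, the sets or the scale. A great circle lies in a plane, so the number of steps
  around the annulus is the same in every dimension. The step sizes differ on purpose: chains
  extracted from the hypotheses have step 1/40, chains in \<open>G - E\<close> only 1/2, and the gap
  pays for exchanging one distance function for another. The radii 13/10 and 17/10 leave the same
  margin \<open>3/10 * r\<close> to the ball of radius \<open>r\<close>, which contains
  \<open>E\<close>, and to the sphere of radius \<open>2 * r\<close>, inside which everything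
  belongs to \<open>G\<close>. Connectedness of \<open>G - E\<close> is itself a conclusion, drawn
  from the chains; hence chains are studied in open sets with nonempty complement.\<close>

lemma edist_nonneg [simp]: "0 \<le> edist n x y"
  by (simp add: edist_def)

lemma edist_self [simp]: "edist n x x = 0"
  by (simp add: edist_def L2_set_0')

lemma edist_commute: "edist n x y = edist n y x"
  by (simp add: edist_def L2_set_def power2_commute)

lemma edist_triangle: "edist n x z \<le> edist n x y + edist n y z"
  using L2_set_triangle_ineq[of "\<lambda>i. x i - y i" "\<lambda>i. y i - z i" "{..<n}"]
  by (simp add: edist_def)

lemma abs_diff_le_edist:
  assumes "i < n"
  shows "\<bar>x i - y i\<bar> \<le> edist n x y"
  using member_le_L2_set[of "{..<n}" i "\<lambda>i. x i - y i"]
    member_le_L2_set[of "{..<n}" i "\<lambda>i. y i - x i"] assms edist_commute[of n x y]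
  by (simp add: edist_def)

lemma edist_eq_0_imp_eq:
  assumes "edist n x y = 0" "x \<in> topspace (Euclidean_space n)" "y \<in> topspace (Euclidean_space n)"
  shows "x = y"
proof
  fix i
  show "x i = y i"
    using abs_diff_le_edist[of i n x y] assms
    by (cases "i < n") (auto simp: topspace_Euclidean_space)
qed

definition seg_point :: "(nat \<Rightarrow> real) \<Rightarrow> (nat \<Rightarrow> real) \<Rightarrow> real \<Rightarrow> nat \<Rightarrow> real" where
  "seg_point x y t = (\<lambda>i. (1 - t) * x i + t * y i)"

lemma seg_point_0 [simp]: "seg_point x y 0 = x"
  and seg_point_1 [simp]: "seg_point x y 1 = y"
  by (simp_all add: seg_point_def)

lemma seg_point_in_space:
  "\<lbrakk>x \<in> topspace (Euclidean_space n); y \<in> topspace (Euclidean_space n)\<rbrakk>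
    \<Longrightarrow> seg_point x y t \<in> topspace (Euclidean_space n)"
  by (simp add: topspace_Euclidean_space seg_point_def)

lemma edist_seg_point: "edist n (seg_point x y s) (seg_point x y t) = \<bar>s - t\<bar> * edist n x y"
proof -
  have "edist n (seg_point x y s) (seg_point x y t) = L2_set (\<lambda>i. (t - s) * (x i - y i)) {..<n}"
    by (simp add: edist_def seg_point_def algebra_simps)
  also have "\<dots> = L2_set (\<lambda>i. \<bar>s - t\<bar> * (x i - y i)) {..<n}"
    unfolding L2_set_def power_mult_distrib power2_abs power2_commute[of t s] ..
  finally show ?thesis
    by (simp add: edist_def L2_set_right_distrib)
qed

lemma edist_seg_point_left: "0 \<le> t \<Longrightarrow> edist n x (seg_point x y t) = t * edist n x y"
  using edist_seg_point[of n x y 0 t] by simp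

lemma continuous_map_edist: "continuous_map (Euclidean_space n) euclideanreal (edist n x)"
proof -
  have "continuous_map (Euclidean_space n) euclideanreal (\<lambda>y. y i)" for i
    unfolding Euclidean_space_def
    by (intro continuous_map_from_subtopology continuous_map_product_projection) auto
  then show ?thesis
    unfolding edist_def L2_set_def by (intro continuous_intros) auto
qed

lemma openin_euclid_ball: "openin (Euclidean_space n) (euclid_ball n x e)"
proof -
  have "openin (Euclidean_space n) {y \<in> topspace (Euclidean_space n). edist n x y \<in> {..<e}}"
    by (rule openin_continuous_map_preimage[OF continuous_map_edist]) auto
  then show ?thesis
    by (simp add: euclid_ball_def)
qed

text \<open>Links the product topology to \<open>edist\<close>. Only finitely many coordinates can
  move, so a minimum of coordinate radii fits a ball into a box.\<close>

lemma openin_Euclidean_space_iff: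
  "openin (Euclidean_space n) U \<longleftrightarrow>
     U \<subseteq> topspace (Euclidean_space n) \<and> (\<forall>x\<in>U. \<exists>e>0. euclid_ball n x e \<subseteq> U)"
proof (intro iffI conjI ballI)
  assume U: "openin (Euclidean_space n) U"
  then show sub: "U \<subseteq> topspace (Euclidean_space n)"
    by (rule openin_subset)
  fix x assume x: "x \<in> U"
  obtain T where T: "openin (powertop_real UNIV) T" "U = T \<inter> {x. \<forall>i\<ge>n. x i = 0}"
    using U by (auto simp: Euclidean_space_def openin_subtopology)
  then obtain W where W: "\<And>i. open (W i)" "x \<in> PiE UNIV W" "PiE UNIV W \<subseteq> T"
  proof -
    have "x \<in> T"
      using x T(2) by blast
    then obtain W where "\<forall>i\<in>UNIV. openin euclideanreal (W i)" "x \<in> PiE UNIV W" "PiE UNIV W \<subseteq> T"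
      using T(1) unfolding openin_product_topology_alt by blast
    then show ?thesis
      by (intro that[of W]) auto
  qed
  have "\<exists>e>0. \<forall>y. \<bar>y - x i\<bar> < e \<longrightarrow> y \<in> W i" for i
    using W(1)[of i] W(2) unfolding open_dist by (auto simp: dist_real_def PiE_iff)
  then obtain e where e: "\<And>i. e i > 0" "\<And>i y. \<bar>y - x i\<bar> < e i \<Longrightarrow> y \<in> W i"
    by metis
  \<comment> \<open>\<open>insert 1\<close> keeps the set nonempty for \<open>n = 0\<close>.\<close>
  define d where "d = Min (insert 1 (e ` {..<n}))"
  have "d > 0"
    by (simp add: d_def e(1))
  moreover have "euclid_ball n x d \<subseteq> U"
  proof
    fix y assume y: "y \<in> euclid_ball n x d"
    have "y i \<in> W i" for i
    proof (cases "i < n")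
      case True
      have "\<bar>y i - x i\<bar> \<le> edist n x y"
        using abs_diff_le_edist[OF True, of x y] by linarith
      moreover have "d \<le> e i"
        unfolding d_def using True by (intro Min_le) auto
      ultimately show ?thesis
        using y by (intro e(2)) (simp add: euclid_ball_def)
    next
      case False
      then have "y i = x i"
        using y sub x by (auto simp: euclid_ball_def topspace_Euclidean_space)
      then show ?thesis
        using W(2) by (auto simp: PiE_iff)
    qed
    then show "y \<in> U"
      using W(3) y T(2) by (auto simp: euclid_ball_def topspace_Euclidean_space PiE_iff)
  qed
  ultimately show "\<exists>e>0. euclid_ball n x e \<subseteq> U" by blast
next
  assume *: "U \<subseteq> topspace (Euclidean_space n) \<and> (\<forall>x\<in>U. \<exists>e>0. euclid_ball n x e \<subseteq> U)"
  show "openin (Euclidean_space n) U"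
  proof (subst openin_subopen, intro ballI)
    fix x assume x: "x \<in> U"
    then obtain e where e: "e > 0" "euclid_ball n x e \<subseteq> U"
      using * by blast
    moreover have "x \<in> euclid_ball n x e"
      using e x * by (auto simp: euclid_ball_def)
    ultimately show "\<exists>T. openin (Euclidean_space n) T \<and> x \<in> T \<and> T \<subseteq> U"
      using openin_euclid_ball by blast
  qed
qed

lemma continuous_map_into_Euclidean_space_iff:
  "continuous_map X (Euclidean_space n) f \<longleftrightarrow>
     f ` topspace X \<subseteq> topspace (Euclidean_space n) \<and>
     (\<forall>i<n. continuous_map X euclideanreal (\<lambda>t. f t i))"
proof (intro iffI conjI)
  assume f: "continuous_map X (Euclidean_space n) f"
  then show "f ` topspace X \<subseteq> topspace (Euclidean_space n)"
    by (rule continuous_map_image_subset_topspace)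
  show "\<forall>i<n. continuous_map X euclideanreal (\<lambda>t. f t i)"
    using f by (auto simp: Euclidean_space_def continuous_map_in_subtopology continuous_map_componentwise_UNIV)
next
  assume f: "f ` topspace X \<subseteq> topspace (Euclidean_space n) \<and>
     (\<forall>i<n. continuous_map X euclideanreal (\<lambda>t. f t i))"
  have "continuous_map X (Euclidean_space n) (\<lambda>t i. if i < n then f t i else 0)"
    using f by (simp add: continuous_map_componentwise_Euclidean_space)
  then show "continuous_map X (Euclidean_space n) f"
    by (rule continuous_map_eq) (use f in \<open>auto simp: topspace_Euclidean_space image_subset_iff\<close>)
qed

lemma pathin_Euclidean_space_iff:
  "pathin (Euclidean_space n) g \<longleftrightarrow>
     g ` {0..1} \<subseteq> topspace (Euclidean_space n) \<and> (\<forall>i<n. continuous_on {0..1} (\<lambda>t. g t i))"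
  by (simp add: pathin_def continuous_map_into_Euclidean_space_iff)

lemma pathin_of_lipschitz:
  assumes "g ` {0..1} \<subseteq> topspace (Euclidean_space n)"
    and lip: "\<And>s t. \<lbrakk>s \<in> {0..1}; t \<in> {0..1}\<rbrakk> \<Longrightarrow> edist n (g s) (g t) \<le> C * \<bar>s - t\<bar>"
  shows "pathin (Euclidean_space n) g"
  unfolding pathin_Euclidean_space_iff
proof (intro conjI allI impI)
  fix i assume i: "i < n"
  have "0 \<le> C"
    using order_trans[OF edist_nonneg lip[of 0 1]] by simp
  then have "C-lipschitz_on {0..1} (\<lambda>t. g t i)"
    using order_trans[OF abs_diff_le_edist[OF i] lip] by (auto simp: lipschitz_on_def dist_real_def)
  then show "continuous_on {0..1} (\<lambda>t. g t i)"
    by (rule lipschitz_on_continuous_on)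
qed fact

text \<open>Preferred to the distance to the frontier: a complement of a difference is a union, so
  removing \<open>E\<close> becomes a minimum, and a strict bound by this distance yields membership
  in \<open>G\<close>.\<close>

definition compl_dist :: "nat \<Rightarrow> (nat \<Rightarrow> real) set \<Rightarrow> (nat \<Rightarrow> real) \<Rightarrow> real" where
  "compl_dist n G x = (INF y \<in> topspace (Euclidean_space n) - G. edist n x y)"

lemma pathin_seg_point:
  assumes "x \<in> topspace (Euclidean_space n)" "y \<in> topspace (Euclidean_space n)"
  shows "pathin (Euclidean_space n) (seg_point x y)"
  by (rule pathin_of_lipschitz[where C = "edist n x y"])
    (use assms in \<open>auto simp: seg_point_in_space edist_seg_point\<close>)

text \<open>The segment from \<open>x\<close> to a point outside \<open>G\<close> is connected, so
  it meets the frontier, at a point no farther from \<open>x\<close>. Conversely the frontier of an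
  open set lies in its complement.\<close>

lemma bdry_dist_eq_compl_dist:
  assumes G: "openin (Euclidean_space n) G" "G \<noteq> topspace (Euclidean_space n)" and x: "x \<in> G"
  shows "bdry_dist n G x = compl_dist n G x"
proof -
  let ?X = "Euclidean_space n"
  have G_sub: "G \<subseteq> topspace ?X"
    using G(1) openin_subset by blast
  have hit: "\<exists>b \<in> ?X frontier_of G. edist n x b \<le> edist n x y" if y: "y \<in> topspace ?X - G" for y
  proof -
    have "connectedin ?X (seg_point x y ` {0..1})"
      using x y G_sub by (intro connectedin_path_image pathin_seg_point) auto
    moreover have "x \<in> seg_point x y ` {0..1}" "y \<in> seg_point x y ` {0..1}"
      using image_eqI[of x "seg_point x y" 0 "{0..1}"] image_eqI[of y "seg_point x y" 1 "{0..1}"] by auto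
    ultimately have "seg_point x y ` {0..1} \<inter> ?X frontier_of G \<noteq> {}"
      using x y by (intro connectedin_Int_frontier_of) auto
    then obtain t where t: "t \<in> {0..1}" "seg_point x y t \<in> ?X frontier_of G"
      by blast
    moreover have "t * edist n x y \<le> edist n x y"
      using t by (intro mult_left_le_one_le) auto
    ultimately show ?thesis
      by (intro bexI[of _ "seg_point x y t"]) (auto simp: edist_seg_point_left)
  qed
  have fr: "?X frontier_of G \<subseteq> topspace ?X - G"
    using G(1) by (simp add: frontier_of_openin Diff_mono closure_of_subset_topspace)
  have bdd: "bdd_below (edist n x ` A)" for A
    by (rule bdd_belowI[of _ 0]) auto
  obtain y0 where y0: "y0 \<in> topspace ?X - G"
    using G(2) G_sub by blast
  show ?thesis
    unfolding bdry_dist_def compl_dist_def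
  proof (rule antisym)
    show "(INF y\<in>?X frontier_of G. edist n x y) \<le> (INF y\<in>topspace ?X - G. edist n x y)"
      using y0 hit bdd by (intro cINF_mono) auto
    show "(INF y\<in>topspace ?X - G. edist n x y) \<le> (INF y\<in>?X frontier_of G. edist n x y)"
      using hit[OF y0] bdd fr by (intro cINF_superset_mono) auto
  qed
qed

lemma compl_dist_le:
  "y \<in> topspace (Euclidean_space n) - G \<Longrightarrow> compl_dist n G x \<le> edist n x y"
  unfolding compl_dist_def by (rule cINF_lower) (auto intro: bdd_belowI[of _ 0])

lemma compl_dist_greatest:
  "\<lbrakk>topspace (Euclidean_space n) - G \<noteq> {};
    \<And>y. y \<in> topspace (Euclidean_space n) - G \<Longrightarrow> d \<le> edist n x y\<rbrakk> \<Longrightarrow> d \<le> compl_dist n G x"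
  unfolding compl_dist_def by (rule cINF_greatest)

lemma compl_dist_lipschitz:
  assumes "topspace (Euclidean_space n) - G \<noteq> {}"
  shows "compl_dist n G x \<le> compl_dist n G y + edist n x y"
proof -
  have "compl_dist n G x - edist n x y \<le> compl_dist n G y"
  proof (rule compl_dist_greatest[OF assms])
    fix w assume "w \<in> topspace (Euclidean_space n) - G"
    then have "compl_dist n G x \<le> edist n x w"
      by (rule compl_dist_le)
    then show "compl_dist n G x - edist n x y \<le> edist n y w"
      using edist_triangle[of n x w y] by linarith
  qed
  then show ?thesis by simp
qed

lemma compl_dist_pos:
  assumes "openin (Euclidean_space n) G" "topspace (Euclidean_space n) - G \<noteq> {}" "x \<in> G"
  shows "0 < compl_dist n G x"
proof -
  obtain e where e: "e > 0" "euclid_ball n x e \<subseteq> G"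
    using assms openin_Euclidean_space_iff by blast
  have "e \<le> compl_dist n G x"
    using e by (intro compl_dist_greatest assms) (force simp: euclid_ball_def)
  then show ?thesis
    using e by linarith
qed

lemma in_of_edist_less_compl_dist:
  "\<lbrakk>y \<in> topspace (Euclidean_space n); edist n x y < compl_dist n G x\<rbrakk> \<Longrightarrow> y \<in> G"
  using compl_dist_le[of y n G x] by auto

lemma compl_dist_Diff:
  assumes "topspace (Euclidean_space n) - G \<noteq> {}" "E \<noteq> {}" "E \<subseteq> topspace (Euclidean_space n)"
  shows "compl_dist n (G - E) x =
    min (compl_dist n G x) (compl_dist n (topspace (Euclidean_space n) - E) x)"
proof -
  have "topspace (Euclidean_space n) - (G - E) = (topspace (Euclidean_space n) - G) \<union> E"
    "topspace (Euclidean_space n) - (topspace (Euclidean_space n) - E) = E"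
    using assms by auto
  moreover have "(INF y\<in>A \<union> E. edist n x y) = min (INF y\<in>A. edist n x y) (INF y\<in>E. edist n x y)"
    if "A \<noteq> {}" for A
  proof -
    have "bdd_below (edist n x ` B)" for B
      by (rule bdd_belowI[of _ 0]) auto
    then show ?thesis
      using cINF_union[of A "edist n x" E] that assms by (simp add: inf_min)
  qed
  ultimately show ?thesis
    using assms by (simp add: compl_dist_def)
qed

section \<open>Arc length\<close>

lemma polygonal_lengthsI:
  "\<lbrakk>\<And>i j. \<lbrakk>i \<le> j; j \<le> m\<rbrakk> \<Longrightarrow> t i \<le> t j; \<And>i. i \<le> m \<Longrightarrow> a \<le> t i \<and> t i \<le> b\<rbrakk>
    \<Longrightarrow> (\<Sum>i<m. edist n (\<gamma> (t i)) (\<gamma> (t (Suc i)))) \<in> polygonal_lengths n \<gamma> a b"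
  unfolding polygonal_lengths_def by (auto intro!: exI[of _ m] exI[of _ t] mono_onI)

lemma polygonal_lengthsE:
  assumes "S \<in> polygonal_lengths n \<gamma> a b"
  obtains t m where "S = (\<Sum>i<m. edist n (\<gamma> (t i)) (\<gamma> (t (Suc i))))"
    "\<forall>i j. i \<le> j \<longrightarrow> j \<le> m \<longrightarrow> t i \<le> t j" "\<forall>i\<le>m. a \<le> t i \<and> t i \<le> b"
proof -
  obtain t m where "S = (\<Sum>i<m. edist n (\<gamma> (t i)) (\<gamma> (t (Suc i))))"
    "mono_on {..m} t" "t ` {..m} \<subseteq> {a..b}"
    using assms unfolding polygonal_lengths_def by blast
  then show ?thesis
    by (intro that[of t m]) (auto simp: mono_on_def image_subset_iff)
qed

lemma polygonal_lengths_mono: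
  "\<lbrakk>a' \<le> a; b \<le> b'\<rbrakk> \<Longrightarrow> polygonal_lengths n \<gamma> a b \<subseteq> polygonal_lengths n \<gamma> a' b'"
  unfolding polygonal_lengths_def by fastforce

lemma edist_in_polygonal_lengths:
  assumes "a \<le> s" "s \<le> t" "t \<le> b"
  shows "edist n (\<gamma> s) (\<gamma> t) \<in> polygonal_lengths n \<gamma> a b"
  using polygonal_lengthsI[of 1 "\<lambda>i. if i = 0 then s else t" a b n \<gamma>] assms by auto

lemma polygonal_lengths_concat:
  assumes "S \<in> polygonal_lengths n \<gamma> a b" "T \<in> polygonal_lengths n \<gamma> b c"
  obtains U where "U \<in> polygonal_lengths n \<gamma> a c" "S + T \<le> U"
proof -
  from assms(1) obtain t m where S: "S = (\<Sum>i<m. edist n (\<gamma> (t i)) (\<gamma> (t (Suc i))))"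
    and t0: "\<forall>i j. i \<le> j \<longrightarrow> j \<le> m \<longrightarrow> t i \<le> t j" "\<forall>i\<le>m. a \<le> t i \<and> t i \<le> b"
    by (rule polygonal_lengthsE)
  note t = t0[rule_format]
  from assms(2) obtain u k where T: "T = (\<Sum>i<k. edist n (\<gamma> (u i)) (\<gamma> (u (Suc i))))"
    and u0: "\<forall>i j. i \<le> j \<longrightarrow> j \<le> k \<longrightarrow> u i \<le> u j" "\<forall>i\<le>k. b \<le> u i \<and> u i \<le> c"
    by (rule polygonal_lengthsE)
  note u = u0[rule_format]
  \<comment> \<open>The nodes are \<open>t 0, ..., t m, u 0, ..., u k\<close>, hence
    \<open>Suc m + k\<close> segments. The joining segment from \<open>t m\<close> to
    \<open>u 0\<close> is a surplus, so the result is only an inequality.\<close>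
  define w where "w i = (if i \<le> m then t i else u (i - Suc m))" for i
  let ?e = "\<lambda>i. edist n (\<gamma> (w i)) (\<gamma> (w (Suc i)))"
  have tb: "t i \<le> u j" if "i \<le> m" "j \<le> k" for i j
    using t(2)[OF that(1)] u(2)[OF that(2)] by linarith
  have ac: "a \<le> b" "b \<le> c"
    using t(2)[of 0] u(2)[of 0] by auto
  have "(\<Sum>i<Suc m + k. ?e i) \<in> polygonal_lengths n \<gamma> a c"
  proof (rule polygonal_lengthsI)
    show "w i \<le> w j" if "i \<le> j" "j \<le> Suc m + k" for i j
      unfolding w_def using that t(1) u(1) tb by auto
    show "a \<le> w i \<and> w i \<le> c" if "i \<le> Suc m + k" for i
    proof (cases "i \<le> m")
      case False
      then have "i - Suc m \<le> k"
        using that by auto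
      then show ?thesis
        using u(2)[of "i - Suc m"] ac False by (simp add: w_def)
    qed (use t(2)[of i] ac in \<open>auto simp: w_def\<close>)
  qed
  moreover have "S + T \<le> (\<Sum>i<Suc m + k. ?e i)"
  proof -
    have "(\<Sum>i<Suc m + k. ?e i) = (\<Sum>i<Suc m. ?e i) + (\<Sum>i<k. ?e (Suc m + i))"
      by (induction k) auto
    moreover have "(\<Sum>i<k. ?e (Suc m + i)) = T"
      unfolding T by (rule sum.cong) (auto simp: w_def)
    moreover have "S = (\<Sum>i<m. ?e i)"
      unfolding S by (rule sum.cong) (auto simp: w_def)
    ultimately show ?thesis
      by simp
  qed
  ultimately show ?thesis
    using that by blast
qed

text \<open>Clamping every node at \<open>b\<close> from above and from below gives two polygons
  over the same index set, so \<open>b\<close> need not be located among the nodes. Only a segment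
  that jumps over \<open>b\<close> is really divided, by the triangle inequality.\<close>

lemma polygonal_lengths_split:
  assumes "U \<in> polygonal_lengths n \<gamma> a c" "a \<le> b" "b \<le> c"
  obtains S T where "S \<in> polygonal_lengths n \<gamma> a b" "T \<in> polygonal_lengths n \<gamma> b c" "U \<le> S + T"
proof -
  from assms(1) obtain t m where U: "U = (\<Sum>i<m. edist n (\<gamma> (t i)) (\<gamma> (t (Suc i))))"
    and t0: "\<forall>i j. i \<le> j \<longrightarrow> j \<le> m \<longrightarrow> t i \<le> t j" "\<forall>i\<le>m. a \<le> t i \<and> t i \<le> c"
    by (rule polygonal_lengthsE)
  note t = t0[rule_format]
  let ?S = "\<lambda>i. edist n (\<gamma> (min (t i) b)) (\<gamma> (min (t (Suc i)) b))"
  let ?T = "\<lambda>i. edist n (\<gamma> (max (t i) b)) (\<gamma> (max (t (Suc i)) b))"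
  have "(\<Sum>i<m. ?S i) \<in> polygonal_lengths n \<gamma> a b"
  proof (rule polygonal_lengthsI)
    show "min (t i) b \<le> min (t j) b" if "i \<le> j" "j \<le> m" for i j
      using t(1)[OF that] by (rule min.mono) simp
    show "a \<le> min (t i) b \<and> min (t i) b \<le> b" if "i \<le> m" for i
      using t(2)[OF that] assms by auto
  qed
  moreover have "(\<Sum>i<m. ?T i) \<in> polygonal_lengths n \<gamma> b c"
  proof (rule polygonal_lengthsI)
    show "max (t i) b \<le> max (t j) b" if "i \<le> j" "j \<le> m" for i j
      using t(1)[OF that] by (rule max.mono) simp
    show "b \<le> max (t i) b \<and> max (t i) b \<le> c" if "i \<le> m" for i
      using t(2)[OF that] assms by auto
  qed
  moreover have "U \<le> (\<Sum>i<m. ?S i) + (\<Sum>i<m. ?T i)"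
    unfolding U sum.distrib[symmetric]
  proof (rule sum_mono)
    fix i assume "i \<in> {..<m}"
    then have "t i \<le> t (Suc i)"
      using t(1)[of i "Suc i"] by simp
    then consider "t (Suc i) \<le> b" | "b \<le> t i" | "t i \<le> b" "b \<le> t (Suc i)"
      by linarith
    then show "edist n (\<gamma> (t i)) (\<gamma> (t (Suc i))) \<le> ?S i + ?T i"
      by cases (use \<open>t i \<le> t (Suc i)\<close> edist_triangle in \<open>auto simp: min_def max_def\<close>)
  qed
  ultimately show ?thesis
    using that by blast
qed

lemma rectifiable_bdd_above:
  "\<lbrakk>rectifiable n \<gamma>; 0 \<le> a; b \<le> 1\<rbrakk> \<Longrightarrow> bdd_above (polygonal_lengths n \<gamma> a b)"
  unfolding rectifiable_def using bdd_above_mono polygonal_lengths_mono by metis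

lemma le_curve_length:
  "\<lbrakk>rectifiable n \<gamma>; 0 \<le> a; b \<le> 1; S \<in> polygonal_lengths n \<gamma> a b\<rbrakk> \<Longrightarrow> S \<le> curve_length n \<gamma> a b"
  unfolding curve_length_def by (rule cSup_upper) (auto intro: rectifiable_bdd_above)

lemma polygonal_lengths_nonempty: "a \<le> b \<Longrightarrow> polygonal_lengths n \<gamma> a b \<noteq> {}"
  using edist_in_polygonal_lengths[of a a b b] by auto

lemma curve_length_least:
  "\<lbrakk>a \<le> b; \<And>S. S \<in> polygonal_lengths n \<gamma> a b \<Longrightarrow> S \<le> c\<rbrakk> \<Longrightarrow> curve_length n \<gamma> a b \<le> c"
  unfolding curve_length_def by (rule cSup_least) (auto simp: polygonal_lengths_nonempty)

lemma edist_le_curve_length: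
  "\<lbrakk>rectifiable n \<gamma>; 0 \<le> a; a \<le> b; b \<le> 1\<rbrakk> \<Longrightarrow> edist n (\<gamma> a) (\<gamma> b) \<le> curve_length n \<gamma> a b"
  by (intro le_curve_length edist_in_polygonal_lengths) auto

lemma curve_length_nonneg:
  "\<lbrakk>rectifiable n \<gamma>; 0 \<le> a; a \<le> b; b \<le> 1\<rbrakk> \<Longrightarrow> 0 \<le> curve_length n \<gamma> a b"
  using edist_le_curve_length edist_nonneg order_trans by blast

lemma curve_length_add:
  assumes "rectifiable n \<gamma>" "0 \<le> a" "a \<le> b" "b \<le> c" "c \<le> 1"
  shows "curve_length n \<gamma> a c = curve_length n \<gamma> a b + curve_length n \<gamma> b c"
proof (rule antisym)
  show "curve_length n \<gamma> a c \<le> curve_length n \<gamma> a b + curve_length n \<gamma> b c"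
  proof (rule curve_length_least)
    fix U assume "U \<in> polygonal_lengths n \<gamma> a c"
    then obtain S T where "S \<in> polygonal_lengths n \<gamma> a b" "T \<in> polygonal_lengths n \<gamma> b c" "U \<le> S + T"
      by (rule polygonal_lengths_split[OF _ assms(3,4)])
    then show "U \<le> curve_length n \<gamma> a b + curve_length n \<gamma> b c"
      using le_curve_length[of n \<gamma> a b S] le_curve_length[of n \<gamma> b c T] assms by linarith
  qed (use assms in auto)
  have "S + T \<le> curve_length n \<gamma> a c"
    if ST: "S \<in> polygonal_lengths n \<gamma> a b" "T \<in> polygonal_lengths n \<gamma> b c" for S T
  proof -
    obtain U where "U \<in> polygonal_lengths n \<gamma> a c" "S + T \<le> U"
      using ST by (rule polygonal_lengths_concat)
    then show ?thesis
      using le_curve_length[of n \<gamma> a c U] assms by linarith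
  qed
  then have "curve_length n \<gamma> a b \<le> curve_length n \<gamma> a c - T" if "T \<in> polygonal_lengths n \<gamma> b c" for T
    using assms that by (intro curve_length_least) (auto simp: algebra_simps)
  then have "curve_length n \<gamma> b c \<le> curve_length n \<gamma> a c - curve_length n \<gamma> a b"
    using assms by (intro curve_length_least) (auto simp: algebra_simps)
  then show "curve_length n \<gamma> a b + curve_length n \<gamma> b c \<le> curve_length n \<gamma> a c"
    by simp
qed

lemma continuous_on_edist_pathin:
  assumes "pathin (Euclidean_space n) \<gamma>"
    and "continuous_on A u" "u ` A \<subseteq> {0..1}" "continuous_on A w" "w ` A \<subseteq> {0..1}"
  shows "continuous_on A (\<lambda>p. edist n (\<gamma> (u p)) (\<gamma> (w p)))"
proof -
  have *: "continuous_on A (\<lambda>p. \<gamma> (u p) i)"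
    if "i < n" "continuous_on A u" "u ` A \<subseteq> {0..1}" for i u
    by (rule continuous_on_compose2[of "{0..1}" "\<lambda>t. \<gamma> t i"])
      (use assms(1) that in \<open>auto simp: pathin_Euclidean_space_iff\<close>)
  show ?thesis
    unfolding edist_def L2_set_def using assms by (intro continuous_intros *) auto
qed

text \<open>
  Both one-sided limits of the length function come from moving the nodes of a polygon
  out of a one-sided neighbourhood of an end point; no refinement of the partition is needed.
\<close>

lemma curve_length_approx_left:
  assumes \<gamma>: "pathin (Euclidean_space n) \<gamma>" "rectifiable n \<gamma>"
    and ab: "0 \<le> a" "a < b" "b \<le> 1" and "\<epsilon> > 0"
  obtains p where "a \<le> p" "p < b" "curve_length n \<gamma> a b - \<epsilon> < curve_length n \<gamma> a p"
proof -
  obtain S where S: "S \<in> polygonal_lengths n \<gamma> a b" "curve_length n \<gamma> a b - \<epsilon> < S"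
    using less_cSup_iff[OF polygonal_lengths_nonempty[of a b n \<gamma>] rectifiable_bdd_above[OF \<gamma>(2), of a b], of "curve_length n \<gamma> a b - \<epsilon>"]
      ab \<open>\<epsilon> > 0\<close> unfolding curve_length_def by auto
  from S(1) obtain t m where St: "S = (\<Sum>i<m. edist n (\<gamma> (t i)) (\<gamma> (t (Suc i))))"
    and t0: "\<forall>i j. i \<le> j \<longrightarrow> j \<le> m \<longrightarrow> t i \<le> t j" "\<forall>i\<le>m. a \<le> t i \<and> t i \<le> b"
    by (rule polygonal_lengthsE)
  note t = t0[rule_format]
  define f where "f p = (\<Sum>i<m. edist n (\<gamma> (min (t i) p)) (\<gamma> (min (t (Suc i)) p)))" for p
  have "continuous_on {a..b} (\<lambda>p. edist n (\<gamma> (min (t i) p)) (\<gamma> (min (t (Suc i)) p)))" if "i < m" for i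
    using t(2)[of i] t(2)[of "Suc i"] that ab
    by (intro continuous_on_edist_pathin[OF \<gamma>(1)] continuous_intros)
      (auto simp: min_le_iff_disj le_max_iff_disj)
  then have "continuous_on {a..b} f"
    unfolding f_def by (intro continuous_on_sum) auto
  moreover have f_end: "f b = S"
    unfolding f_def St
  proof (rule sum.cong)
    fix i assume "i \<in> {..<m}"
    then show "edist n (\<gamma> (min (t i) b)) (\<gamma> (min (t (Suc i)) b)) = edist n (\<gamma> (t i)) (\<gamma> (t (Suc i)))"
      using t(2)[of i] t(2)[of "Suc i"] by (simp add: min_absorb1)
  qed simp
  ultimately obtain d where d: "d > 0" "\<And>p. \<lbrakk>p \<in> {a..b}; \<bar>p - b\<bar> < d\<rbrakk> \<Longrightarrow>
      \<bar>f p - S\<bar> < S - (curve_length n \<gamma> a b - \<epsilon>)"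
    using continuous_on_iff[of "{a..b}" f] S(2) ab unfolding dist_real_def
    by (metis atLeastAtMost_iff diff_gt_0_iff_gt less_imp_le order_refl)
  define p where "p = max a (b - d / 2)"
  have p: "a \<le> p" "p < b" "\<bar>p - b\<bar> < d"
    using d(1) ab unfolding p_def by auto
  have "f p \<in> polygonal_lengths n \<gamma> a p"
    unfolding f_def
  proof (rule polygonal_lengthsI)
    show "min (t i) p \<le> min (t j) p" if "i \<le> j" "j \<le> m" for i j
      using t(1)[OF that] by (rule min.mono) simp
    show "a \<le> min (t i) p \<and> min (t i) p \<le> p" if "i \<le> m" for i
      using t(2)[OF that] p by auto
  qed
  then have "f p \<le> curve_length n \<gamma> a p"
    using \<gamma> ab p by (intro le_curve_length) auto
  moreover have "curve_length n \<gamma> a b - \<epsilon> < f p"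
    using d(2)[of p] p by auto
  ultimately show ?thesis
    using that p by force
qed

lemma curve_length_approx_right:
  assumes \<gamma>: "pathin (Euclidean_space n) \<gamma>" "rectifiable n \<gamma>"
    and ab: "0 \<le> a" "a < b" "b \<le> 1" and "\<epsilon> > 0"
  obtains p where "a < p" "p \<le> b" "curve_length n \<gamma> a b - \<epsilon> < curve_length n \<gamma> p b"
proof -
  obtain S where S: "S \<in> polygonal_lengths n \<gamma> a b" "curve_length n \<gamma> a b - \<epsilon> < S"
    using less_cSup_iff[OF polygonal_lengths_nonempty[of a b n \<gamma>] rectifiable_bdd_above[OF \<gamma>(2), of a b], of "curve_length n \<gamma> a b - \<epsilon>"]
      ab \<open>\<epsilon> > 0\<close> unfolding curve_length_def by auto
  from S(1) obtain t m where St: "S = (\<Sum>i<m. edist n (\<gamma> (t i)) (\<gamma> (t (Suc i))))"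
    and t0: "\<forall>i j. i \<le> j \<longrightarrow> j \<le> m \<longrightarrow> t i \<le> t j" "\<forall>i\<le>m. a \<le> t i \<and> t i \<le> b"
    by (rule polygonal_lengthsE)
  note t = t0[rule_format]
  define f where "f p = (\<Sum>i<m. edist n (\<gamma> (max (t i) p)) (\<gamma> (max (t (Suc i)) p)))" for p
  have "continuous_on {a..b} (\<lambda>p. edist n (\<gamma> (max (t i) p)) (\<gamma> (max (t (Suc i)) p)))" if "i < m" for i
    using t(2)[of i] t(2)[of "Suc i"] that ab
    by (intro continuous_on_edist_pathin[OF \<gamma>(1)] continuous_intros)
      (auto simp: min_le_iff_disj le_max_iff_disj)
  then have "continuous_on {a..b} f"
    unfolding f_def by (intro continuous_on_sum) auto
  moreover have f_end: "f a = S"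
    unfolding f_def St
  proof (rule sum.cong)
    fix i assume "i \<in> {..<m}"
    then show "edist n (\<gamma> (max (t i) a)) (\<gamma> (max (t (Suc i)) a)) = edist n (\<gamma> (t i)) (\<gamma> (t (Suc i)))"
      using t(2)[of i] t(2)[of "Suc i"] by (simp add: max_absorb1)
  qed simp
  ultimately obtain d where d: "d > 0" "\<And>p. \<lbrakk>p \<in> {a..b}; \<bar>p - a\<bar> < d\<rbrakk> \<Longrightarrow>
      \<bar>f p - S\<bar> < S - (curve_length n \<gamma> a b - \<epsilon>)"
    using continuous_on_iff[of "{a..b}" f] S(2) ab unfolding dist_real_def
    by (metis atLeastAtMost_iff diff_gt_0_iff_gt less_imp_le order_refl)
  define p where "p = min b (a + d / 2)"
  have p: "a < p" "p \<le> b" "\<bar>p - a\<bar> < d"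
    using d(1) ab unfolding p_def by auto
  have "f p \<in> polygonal_lengths n \<gamma> p b"
    unfolding f_def
  proof (rule polygonal_lengthsI)
    show "max (t i) p \<le> max (t j) p" if "i \<le> j" "j \<le> m" for i j
      using t(1)[OF that] by (rule max.mono) simp
    show "p \<le> max (t i) p \<and> max (t i) p \<le> b" if "i \<le> m" for i
      using t(2)[OF that] p by auto
  qed
  then have "f p \<le> curve_length n \<gamma> p b"
    using \<gamma> ab p by (intro le_curve_length) auto
  moreover have "curve_length n \<gamma> a b - \<epsilon> < f p"
    using d(2)[of p] p by auto
  ultimately show ?thesis
    using that p by force
qed

lemma curve_length_mono:
  assumes "rectifiable n \<gamma>" "0 \<le> s" "s \<le> t" "t \<le> 1"
  shows "curve_length n \<gamma> 0 s \<le> curve_length n \<gamma> 0 t"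
  using curve_length_add[of n \<gamma> 0 s t] curve_length_nonneg[of n \<gamma> s t] assms by simp

text \<open>Length is monotone in the end point, so one parameter on each side with nearly the same
  length controls all parameters in between.\<close>

lemma continuous_on_curve_length:
  assumes \<gamma>: "pathin (Euclidean_space n) \<gamma>" "rectifiable n \<gamma>"
  shows "continuous_on {0..1} (curve_length n \<gamma> 0)"
  unfolding continuous_on_iff
proof (intro ballI allI impI)
  fix t \<epsilon> :: real assume t: "t \<in> {0..1}" and \<epsilon>: "\<epsilon> > 0"
  let ?v = "curve_length n \<gamma> 0"
  have "\<exists>d>0. \<forall>s\<in>{0..1}. t - d < s \<and> s \<le> t \<longrightarrow> \<bar>?v s - ?v t\<bar> < \<epsilon>"
  proof (cases "t = 0")
    case True
    then show ?thesis
      using \<epsilon> by (intro exI[of _ 1]) auto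
  next
    case False
    then obtain p where p: "0 \<le> p" "p < t" "?v t - \<epsilon> < ?v p"
      using curve_length_approx_left[OF \<gamma>, of 0 t \<epsilon>] t \<epsilon> by auto
    have "\<bar>?v s - ?v t\<bar> < \<epsilon>" if "s \<in> {0..1}" "p < s" "s \<le> t" for s
      using curve_length_mono[OF \<gamma>(2), of p s] curve_length_mono[OF \<gamma>(2), of s t] that p t by auto
    then show ?thesis
      using p by (intro exI[of _ "t - p"]) auto
  qed
  then obtain d1 where d1: "d1 > 0" "\<And>s. \<lbrakk>s \<in> {0..1}; t - d1 < s; s \<le> t\<rbrakk> \<Longrightarrow> \<bar>?v s - ?v t\<bar> < \<epsilon>"
    by blast
  have "\<exists>d>0. \<forall>s\<in>{0..1}. t \<le> s \<and> s < t + d \<longrightarrow> \<bar>?v s - ?v t\<bar> < \<epsilon>"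
  proof (cases "t = 1")
    case True
    then show ?thesis
      using \<epsilon> by (intro exI[of _ 1]) auto
  next
    case False
    then obtain p where p: "t < p" "p \<le> 1" "curve_length n \<gamma> t 1 - \<epsilon> < curve_length n \<gamma> p 1"
      using curve_length_approx_right[OF \<gamma>, of t 1 \<epsilon>] t \<epsilon> by auto
    \<comment> \<open>The approximation concerns the tails up to 1; additivity turns it into a bound
      for the lengths from 0.\<close>
    then have "?v p < ?v t + \<epsilon>"
      using curve_length_add[OF \<gamma>(2), of 0 t 1] curve_length_add[OF \<gamma>(2), of 0 p 1] t by auto
    then have "\<bar>?v s - ?v t\<bar> < \<epsilon>" if "s \<in> {0..1}" "t \<le> s" "s < p" for s
      using curve_length_mono[OF \<gamma>(2), of t s] curve_length_mono[OF \<gamma>(2), of s p] that p t by auto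
    then show ?thesis
      using p by (intro exI[of _ "p - t"]) auto
  qed
  then obtain d2 where d2: "d2 > 0" "\<And>s. \<lbrakk>s \<in> {0..1}; t \<le> s; s < t + d2\<rbrakk> \<Longrightarrow> \<bar>?v s - ?v t\<bar> < \<epsilon>"
    by blast
  have "dist (?v s) (?v t) < \<epsilon>" if "s \<in> {0..1}" "dist s t < min d1 d2" for s
    using that d1(2)[of s] d2(2)[of s] by (cases "s \<le> t") (auto simp: dist_real_def)
  then show "\<exists>d>0. \<forall>s\<in>{0..1}. dist s t < d \<longrightarrow> dist (?v s) (?v t) < \<epsilon>"
    using d1(1) d2(1) by (intro exI[of _ "min d1 d2"]) auto
qed

lemma curve_length_self:
  "\<lbrakk>rectifiable n \<gamma>; 0 \<le> a; a \<le> 1\<rbrakk> \<Longrightarrow> curve_length n \<gamma> a a = 0"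
  using curve_length_add[of n \<gamma> a a a] by simp

section \<open>The parametrization by arc length\<close>

lemma arc_length_param_obtain:
  assumes \<gamma>: "pathin (Euclidean_space n) \<gamma>" "rectifiable n \<gamma>" and "s \<in> {0..curve_length n \<gamma> 0 1}"
  obtains t where "t \<in> {0..1}" "curve_length n \<gamma> 0 t = s" "arc_length_param n \<gamma> s = \<gamma> t"
proof -
  \<comment> \<open>By the intermediate value theorem every arc length is attained, so the
    \<open>SOME\<close> in \<open>arc_length_param\<close> has a witness.\<close>
  have "\<exists>t. t \<in> {0..1} \<and> curve_length n \<gamma> 0 t = s"
    using IVT'[of "curve_length n \<gamma> 0" 0 s 1] continuous_on_curve_length[OF \<gamma>] assms
    by (auto simp: curve_length_self)
  then show ?thesis
    using someI_ex[of "\<lambda>t. t \<in> {0..1} \<and> curve_length n \<gamma> 0 t = s"] that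
    unfolding arc_length_param_def by blast
qed

lemma edist_le_curve_length_diff:
  assumes "rectifiable n \<gamma>" "s \<in> {0..1}" "t \<in> {0..1}"
  shows "edist n (\<gamma> s) (\<gamma> t) \<le> \<bar>curve_length n \<gamma> 0 s - curve_length n \<gamma> 0 t\<bar>"
  using assms(2,3)
proof (induction s t rule: linorder_wlog)
  case (le s t)
  then show ?case
    using edist_le_curve_length[OF assms(1), of s t] curve_length_add[OF assms(1), of 0 s t] by auto
next
  case (sym s t)
  then show ?case
    by (simp add: edist_commute abs_minus_commute)
qed

lemma arc_length_param_lipschitz:
  assumes \<gamma>: "pathin (Euclidean_space n) \<gamma>" "rectifiable n \<gamma>"
    and "s \<in> {0..curve_length n \<gamma> 0 1}" "s' \<in> {0..curve_length n \<gamma> 0 1}"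
  shows "edist n (arc_length_param n \<gamma> s) (arc_length_param n \<gamma> s') \<le> \<bar>s - s'\<bar>"
  using arc_length_param_obtain[OF \<gamma> assms(3)] arc_length_param_obtain[OF \<gamma> assms(4)]
    edist_le_curve_length_diff[OF \<gamma>(2)] by metis

lemma arc_length_param_ends:
  assumes \<gamma>: "pathin (Euclidean_space n) \<gamma>" "rectifiable n \<gamma>"
  shows "arc_length_param n \<gamma> 0 = \<gamma> 0" "arc_length_param n \<gamma> (curve_length n \<gamma> 0 1) = \<gamma> 1"
proof -
  have *: "arc_length_param n \<gamma> (curve_length n \<gamma> 0 u) = \<gamma> u" if u: "u \<in> {0..1}" for u
  proof -
    have "curve_length n \<gamma> 0 u \<in> {0..curve_length n \<gamma> 0 1}"
      using curve_length_nonneg[OF \<gamma>(2), of 0 u] curve_length_mono[OF \<gamma>(2), of u 1] u by auto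
    then obtain t where t: "t \<in> {0..1}" "curve_length n \<gamma> 0 t = curve_length n \<gamma> 0 u"
      "arc_length_param n \<gamma> (curve_length n \<gamma> 0 u) = \<gamma> t"
      by (rule arc_length_param_obtain[OF \<gamma>])
    \<comment> \<open>The chosen parameter \<open>t\<close> may differ from \<open>u\<close>, but
      equal arc lengths force equal points.\<close>
    then have "edist n (\<gamma> t) (\<gamma> u) = 0"
      using edist_le_curve_length_diff[OF \<gamma>(2), of t u] u edist_nonneg[of n "\<gamma> t" "\<gamma> u"] by simp
    then have "\<gamma> t = \<gamma> u"
      using \<gamma>(1) t(1) u by (intro edist_eq_0_imp_eq) (auto simp: pathin_Euclidean_space_iff)
    then show ?thesis
      using t by simp
  qed
  show "arc_length_param n \<gamma> 0 = \<gamma> 0"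
    using *[of 0] by (simp add: curve_length_self[OF \<gamma>(2)])
  show "arc_length_param n \<gamma> (curve_length n \<gamma> 0 1) = \<gamma> 1"
    using *[of 1] by simp
qed

lemma polygonal_lengths_le_lipschitz:
  assumes "S \<in> polygonal_lengths n \<gamma> 0 1"
    and lip: "\<And>s t. \<lbrakk>s \<in> {0..1}; t \<in> {0..1}\<rbrakk> \<Longrightarrow> edist n (\<gamma> s) (\<gamma> t) \<le> C * \<bar>s - t\<bar>"
  shows "S \<le> C"
proof -
  from assms(1) obtain t m where S: "S = (\<Sum>i<m. edist n (\<gamma> (t i)) (\<gamma> (t (Suc i))))"
    and t0: "\<forall>i j. i \<le> j \<longrightarrow> j \<le> m \<longrightarrow> t i \<le> t j" "\<forall>i\<le>m. 0 \<le> t i \<and> t i \<le> 1"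
    by (rule polygonal_lengthsE)
  note t = t0[rule_format]
  have "0 \<le> C"
    using order_trans[OF edist_nonneg lip[of 0 1]] by simp
  have "S \<le> (\<Sum>i<m. C * (t (Suc i) - t i))"
    unfolding S
  proof (rule sum_mono)
    fix i assume "i \<in> {..<m}"
    then show "edist n (\<gamma> (t i)) (\<gamma> (t (Suc i))) \<le> C * (t (Suc i) - t i)"
      using lip[of "t i" "t (Suc i)"] t(1)[of i "Suc i"] t(2)[of i] t(2)[of "Suc i"] by simp
  qed
  also have "\<dots> = C * (t m - t 0)"
    by (simp add: sum_distrib_left[symmetric] sum_lessThan_telescope)
  also have "\<dots> \<le> C"
    using t(2)[of m] t(2)[of 0] \<open>0 \<le> C\<close> by (intro mult_left_le) auto
  finally show ?thesis .
qed

section \<open>Quasihyperbolic distance and chains\<close>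

text \<open>Connectedness is left out so that the distance lemmas apply to \<open>G - E\<close>
  before it is known to be connected.\<close>

definition proper_open :: "nat \<Rightarrow> (nat \<Rightarrow> real) set \<Rightarrow> bool" where
  "proper_open n G \<longleftrightarrow> openin (Euclidean_space n) G \<and> topspace (Euclidean_space n) - G \<noteq> {}"

definition qh_admissible ::
    "nat \<Rightarrow> (nat \<Rightarrow> real) set \<Rightarrow> (nat \<Rightarrow> real) \<Rightarrow> (nat \<Rightarrow> real) \<Rightarrow> (real \<Rightarrow> nat \<Rightarrow> real) \<Rightarrow> bool" where
  "qh_admissible n G x y \<gamma> \<longleftrightarrow>
     pathin (Euclidean_space n) \<gamma> \<and> rectifiable n \<gamma> \<and> \<gamma> ` {0..1} \<subseteq> G \<and> \<gamma> 0 = x \<and> \<gamma> 1 = y"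

lemma quasihyperbolic_eq_INF:
  "quasihyperbolic n G x y =
     (INF \<gamma>\<in>Collect (qh_admissible n G x y). line_integral n (\<lambda>z. 1 / bdry_dist n G z) \<gamma>)"
  unfolding quasihyperbolic_def qh_admissible_def by (rule arg_cong[where f = Inf]) auto

lemma bdry_dist_proper_open: "\<lbrakk>proper_open n G; x \<in> G\<rbrakk> \<Longrightarrow> bdry_dist n G x = compl_dist n G x"
  unfolding proper_open_def by (intro bdry_dist_eq_compl_dist) auto

lemma proper_open_dist_pos: "\<lbrakk>proper_open n G; x \<in> G\<rbrakk> \<Longrightarrow> 0 < compl_dist n G x"
  unfolding proper_open_def by (intro compl_dist_pos) auto

lemma proper_open_dist_lipschitz:
  "proper_open n G \<Longrightarrow> compl_dist n G x \<le> compl_dist n G y + edist n x y"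
  unfolding proper_open_def by (intro compl_dist_lipschitz) auto

lemma proper_open_in_space: "\<lbrakk>proper_open n G; x \<in> G\<rbrakk> \<Longrightarrow> x \<in> topspace (Euclidean_space n)"
  unfolding proper_open_def using openin_subset by blast

lemma arc_length_param_in:
  assumes "qh_admissible n G x y \<gamma>" "s \<in> {0..curve_length n \<gamma> 0 1}"
  shows "arc_length_param n \<gamma> s \<in> \<gamma> ` {0..1}" "arc_length_param n \<gamma> s \<in> G"
  using arc_length_param_obtain[of n \<gamma> s] assms unfolding qh_admissible_def
  by (metis imageI, metis imageI subsetD)

text \<open>Supplies the lower bound needed to work with the real-valued infimum. A non-integrable
  integrand has integral 0, so integrability need not be shown.\<close>

lemma line_integral_nonneg:
  assumes G: "proper_open n G" and \<gamma>: "qh_admissible n G x y \<gamma>"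
  shows "0 \<le> line_integral n (\<lambda>z. 1 / bdry_dist n G z) \<gamma>"
proof -
  have "0 \<le> 1 / bdry_dist n G (arc_length_param n \<gamma> s)" if "s \<in> {0..curve_length n \<gamma> 0 1}" for s
    using arc_length_param_in(2)[OF \<gamma> that] bdry_dist_proper_open[OF G] proper_open_dist_pos[OF G]
    by (simp add: less_imp_le)
  then show ?thesis
    unfolding line_integral_def
    by (cases "(\<lambda>s. 1 / bdry_dist n G (arc_length_param n \<gamma> s)) integrable_on {0..curve_length n \<gamma> 0 1}")
      (auto intro: integral_nonneg simp: not_integrable_integral)
qed

lemma lipschitz_imp_qh_admissible:
  assumes "\<gamma> ` {0..1} \<subseteq> G" "G \<subseteq> topspace (Euclidean_space n)"
    and "\<And>s t. \<lbrakk>s \<in> {0..1}; t \<in> {0..1}\<rbrakk> \<Longrightarrow> edist n (\<gamma> s) (\<gamma> t) \<le> C * \<bar>s - t\<bar>"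
  shows "qh_admissible n G (\<gamma> 0) (\<gamma> 1) \<gamma>"
  unfolding qh_admissible_def rectifiable_def
  using assms pathin_of_lipschitz[of \<gamma> n C] polygonal_lengths_le_lipschitz[of _ n \<gamma> C]
  by (auto intro: bdd_aboveI[of _ C])

text \<open>The length is at most \<open>C\<close> and the integrand at most \<open>1 / d\<close>; a
  Lipschitz path is rectifiable, so it competes in the infimum.\<close>

lemma quasihyperbolic_le_lipschitz:
  assumes G: "proper_open n G" and sub: "\<gamma> ` {0..1} \<subseteq> G"
    and lip: "\<And>s t. \<lbrakk>s \<in> {0..1}; t \<in> {0..1}\<rbrakk> \<Longrightarrow> edist n (\<gamma> s) (\<gamma> t) \<le> C * \<bar>s - t\<bar>"
    and d: "d > 0" "\<And>t. t \<in> {0..1} \<Longrightarrow> d \<le> compl_dist n G (\<gamma> t)"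
  shows "quasihyperbolic n G (\<gamma> 0) (\<gamma> 1) \<le> C / d"
proof -
  let ?L = "curve_length n \<gamma> 0 1"
  let ?f = "\<lambda>s. 1 / bdry_dist n G (arc_length_param n \<gamma> s)"
  have "G \<subseteq> topspace (Euclidean_space n)"
    using proper_open_in_space[OF G] by blast
  then have adm: "qh_admissible n G (\<gamma> 0) (\<gamma> 1) \<gamma>"
    using sub lip by (intro lipschitz_imp_qh_admissible)
  have L: "0 \<le> ?L" "?L \<le> C"
    using adm curve_length_nonneg[of n \<gamma> 0 1] curve_length_least[of 0 1 n \<gamma> C]
      polygonal_lengths_le_lipschitz[of _ n \<gamma> C] lip by (auto simp: qh_admissible_def)
  have f: "?f s \<le> 1 / d" if "s \<in> {0..?L}" for s
  proof -
    obtain t where "t \<in> {0..1}" "arc_length_param n \<gamma> s = \<gamma> t"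
      using arc_length_param_in(1)[OF adm \<open>s \<in> {0..?L}\<close>] by auto
    then have "d \<le> bdry_dist n G (arc_length_param n \<gamma> s)"
      using d(2) sub bdry_dist_proper_open[OF G] by (auto simp: image_subset_iff)
    then show ?thesis
      using d(1) by (intro divide_left_mono) auto
  qed
  have "integral {0..?L} ?f \<le> ?L / d"
  proof (cases "?f integrable_on {0..?L}")
    case True
    then have "integral {0..?L} ?f \<le> integral {0..?L} (\<lambda>_. 1 / d)"
      using f by (intro integral_le) auto
    then show ?thesis
      using L by simp
  qed (use L d in \<open>simp add: not_integrable_integral\<close>)
  also have "\<dots> \<le> C / d"
    using L d by (intro divide_right_mono) auto
  finally have "line_integral n (\<lambda>z. 1 / bdry_dist n G z) \<gamma> \<le> C / d"
    unfolding line_integral_def .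
  moreover have "quasihyperbolic n G (\<gamma> 0) (\<gamma> 1) \<le> line_integral n (\<lambda>z. 1 / bdry_dist n G z) \<gamma>"
    unfolding quasihyperbolic_eq_INF
    by (rule cINF_lower) (use adm line_integral_nonneg[OF G] in \<open>auto intro!: bdd_belowI[of _ 0]\<close>)
  ultimately show ?thesis
    by linarith
qed

text \<open>The minimum over both ends makes the relation symmetric, so chains can be
  reversed.\<close>

definition chain_step ::
    "real \<Rightarrow> nat \<Rightarrow> (nat \<Rightarrow> real) set \<Rightarrow> (nat \<Rightarrow> real) \<Rightarrow> (nat \<Rightarrow> real) \<Rightarrow> bool" where
  "chain_step e n G x y \<longleftrightarrow>
     x \<in> G \<and> y \<in> G \<and> edist n x y \<le> e * min (compl_dist n G x) (compl_dist n G y)"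

lemma chain_step_commute: "chain_step e n G x y \<longleftrightarrow> chain_step e n G y x"
  by (auto simp: chain_step_def edist_commute min.commute)

lemma chain_step_refl: "\<lbrakk>proper_open n G; 0 \<le> e; x \<in> G\<rbrakk> \<Longrightarrow> chain_step e n G x x"
  using proper_open_dist_pos[of n G x] by (simp add: chain_step_def)

lemma chain_refl:
  assumes "proper_open n G" "0 \<le> e" "x \<in> G"
  shows "(chain_step e n G ^^ N) x x"
  by (induction N) (use chain_step_refl[OF assms] in auto)

text \<open>Constant steps serve as padding, which lets chains of different lengths be brought to a
  common count.\<close>

lemma chain_mono:
  assumes "proper_open n G" "0 \<le> e" "(chain_step e n G ^^ N) x y" "y \<in> G" "N \<le> M"
  shows "(chain_step e n G ^^ M) x y"
  using relpowp_trans[OF assms(3) chain_refl[OF assms(1,2,4), of "M - N"]] assms(5) by simp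

lemma chain_commute:
  "(chain_step e n G ^^ N) x y \<Longrightarrow> (chain_step e n G ^^ N) y x"
proof (induction N arbitrary: y)
  case (Suc N)
  then obtain w where "(chain_step e n G ^^ N) x w" "chain_step e n G w y"
    by auto
  then show ?case
    using Suc.IH chain_step_commute relpowp_Suc_I2 by metis
qed simp

text \<open>A condition at one end suffices: the distance to the complement at \<open>y\<close> is
  at least that at \<open>x\<close> divided by \<open>1 + e\<close>. The factor is 1/3 for
  half-steps and 1/41 for steps of size 1/40.\<close>

lemma chain_step_of_edist_le:
  assumes G: "proper_open n G" and x: "x \<in> G" "y \<in> topspace (Euclidean_space n)"
    and le: "edist n x y \<le> e / (1 + e) * compl_dist n G x" and e: "e > 0"
  shows "chain_step e n G x y"
proof -
  let ?d = "compl_dist n G x"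
  have d: "0 < ?d"
    by (rule proper_open_dist_pos) fact+
  have "e / (1 + e) * ?d < 1 * ?d"
    using d e by (intro mult_strict_right_mono) auto
  then have "y \<in> G"
    using le x by (intro in_of_edist_less_compl_dist[of y n x G]) auto
  moreover have "edist n x y \<le> e * ?d"
  proof -
    have "e / (1 + e) * ?d \<le> e * ?d"
      using d e by (intro mult_right_mono) (auto simp: field_simps)
    then show ?thesis
      using le by linarith
  qed
  moreover have "edist n x y \<le> e * compl_dist n G y"
  proof -
    have "(1 + e) * edist n x y \<le> e * ?d"
      using le e by (simp add: field_simps)
    also have "\<dots> \<le> e * (compl_dist n G y + edist n x y)"
      using proper_open_dist_lipschitz[OF G, of x y] e by (intro mult_left_mono) auto
    finally show ?thesis
      by (simp add: algebra_simps)
  qed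
  ultimately show ?thesis
    using x e by (simp add: chain_step_def min_def)
qed

section \<open>From chains to Lipschitz paths\<close>

lemma lipschitz_join:
  assumes g: "\<And>s t. \<lbrakk>s \<in> {0..1}; t \<in> {0..1}\<rbrakk> \<Longrightarrow> edist n (g s) (g t) \<le> C * \<bar>s - t\<bar>"
    and h: "\<And>s t. \<lbrakk>s \<in> {0..1}; t \<in> {0..1}\<rbrakk> \<Longrightarrow> edist n (h s) (h t) \<le> C * \<bar>s - t\<bar>"
    and gh: "g 1 = h 0" and st: "s \<in> {0..1}" "t \<in> {0..1::real}"
  defines "j \<equiv> \<lambda>t. if t \<le> 1/2 then g (2 * t) else h (2 * t - 1)"
  shows "edist n (j s) (j t) \<le> (2 * C) * \<bar>s - t\<bar>"
  using st
proof (induction s t rule: linorder_wlog)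
  case (le s t)
  consider "t \<le> 1/2" | "1/2 < s" | "s \<le> 1/2" "1/2 < t"
    by linarith
  then show ?case
  proof cases
    case 1
    then show ?thesis
      using g[of "2 * s" "2 * t"] le unfolding j_def by (simp add: algebra_simps)
  next
    case 2
    then show ?thesis
      using h[of "2 * s - 1" "2 * t - 1"] le unfolding j_def by (simp add: algebra_simps)
  next
    case 3
    have "edist n (j s) (j t) \<le> edist n (g (2 * s)) (g 1) + edist n (h 0) (h (2 * t - 1))"
      using 3 edist_triangle[of n "g (2 * s)" "h (2 * t - 1)" "g 1"] gh unfolding j_def by simp
    also have "\<dots> \<le> C * \<bar>2 * s - 1\<bar> + C * \<bar>0 - (2 * t - 1)\<bar>"
      using 3 le by (intro add_mono g h) auto
    also have "\<dots> = (2 * C) * \<bar>s - t\<bar>"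
      using 3 by (simp add: algebra_simps)
    finally show ?thesis .
  qed
next
  case (sym s t)
  then show ?case
    by (simp add: edist_commute abs_minus_commute)
qed

text \<open>
  A half-step changes the distance to the complement by a factor of at most two. This makes the
  crude bounds of the next lemma sufficient: the Lipschitz constant is comparable, up to a factor
  depending on the number of steps only, with the distance to the complement along the path.
\<close>

lemma chain_lipschitz_path:
  assumes G: "proper_open n G" and "(chain_step (1/2) n G ^^ N) x y" "x \<in> G"
  shows "\<exists>\<gamma>. \<gamma> 0 = x \<and> \<gamma> 1 = y \<and> \<gamma> ` {0..1} \<subseteq> G \<and>
    (\<forall>s\<in>{0..1}. \<forall>t\<in>{0..1}. edist n (\<gamma> s) (\<gamma> t) \<le> (4 ^ N * compl_dist n G x) * \<bar>s - t\<bar>) \<and>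
    (\<forall>t\<in>{0..1}. compl_dist n G x / 2 ^ N \<le> compl_dist n G (\<gamma> t))"
  using assms(2,3)
proof (induction N arbitrary: x)
  case 0
  then show ?case
    using proper_open_dist_pos[OF G, of x] by (intro exI[of _ "\<lambda>_. x"]) auto
next
  case (Suc N)
  from Suc.prems(1) obtain w where w: "chain_step (1/2) n G x w" "(chain_step (1/2) n G ^^ N) w y"
    by (rule relpowp_Suc_E2)
  let ?d = "compl_dist n G x"
  have xw: "x \<in> G" "w \<in> G" "edist n x w \<le> ?d / 2"
    using w(1) by (auto simp: chain_step_def)
  have sp: "x \<in> topspace (Euclidean_space n)" "w \<in> topspace (Euclidean_space n)"
    using proper_open_in_space[OF G] xw by auto
  have d: "0 < ?d"
    using G xw(1) by (rule proper_open_dist_pos)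
  have dw: "?d / 2 \<le> compl_dist n G w" "compl_dist n G w \<le> 2 * ?d"
    using proper_open_dist_lipschitz[OF G, of x w] proper_open_dist_lipschitz[OF G, of w x] xw(3) d
      edist_commute[of n w x] by linarith+
  obtain \<gamma> where \<gamma>: "\<gamma> 0 = w" "\<gamma> 1 = y" "\<gamma> ` {0..1} \<subseteq> G"
    "\<forall>s\<in>{0..1}. \<forall>t\<in>{0..1}. edist n (\<gamma> s) (\<gamma> t) \<le> (4 ^ N * compl_dist n G w) * \<bar>s - t\<bar>"
    "\<forall>t\<in>{0..1}. compl_dist n G w / 2 ^ N \<le> compl_dist n G (\<gamma> t)"
    using Suc.IH[OF w(2) xw(2)] by blast
  define j where "j = (\<lambda>t. if t \<le> 1/2 then seg_point x w (2 * t) else \<gamma> (2 * t - 1))"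
  have seg: "seg_point x w t \<in> G" "?d / 2 \<le> compl_dist n G (seg_point x w t)" if "t \<in> {0..1}" for t
  proof -
    have "edist n x (seg_point x w t) \<le> edist n x w"
      using that by (simp add: edist_seg_point_left mult_left_le_one_le)
    then have *: "edist n x (seg_point x w t) \<le> ?d / 2"
      using xw(3) by linarith
    then show "seg_point x w t \<in> G"
      using seg_point_in_space[OF sp] d by (intro in_of_edist_less_compl_dist[of _ n x G]) auto
    show "?d / 2 \<le> compl_dist n G (seg_point x w t)"
      using * proper_open_dist_lipschitz[OF G, of x "seg_point x w t"] by linarith
  qed
  have "edist n (j s) (j t) \<le> (4 ^ Suc N * ?d) * \<bar>s - t\<bar>" if st: "s \<in> {0..1}" "t \<in> {0..1}" for s t
  proof -
    \<comment> \<open>A common constant for both halves: the segment has length at most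
      \<open>?d / 2\<close>, and the remaining path starts at \<open>w\<close>, whose distance to
      the complement is at most \<open>2 * ?d\<close>. Joining doubles it to
      \<open>4 ^ Suc N * ?d\<close>.\<close>
    let ?C = "2 * 4 ^ N * ?d"
    have "edist n x w \<le> ?C"
    proof -
      have "?d \<le> 4 ^ N * ?d" "?C = 2 * (4 ^ N * ?d)"
        using d by simp_all
      then show ?thesis
        using xw(3) d by linarith
    qed
    then have "edist n (seg_point x w s) (seg_point x w t) \<le> ?C * \<bar>s - t\<bar>" for s t
      unfolding edist_seg_point mult.commute[of "\<bar>s - t\<bar>"] by (rule mult_right_mono) simp
    moreover have "edist n (\<gamma> s) (\<gamma> t) \<le> ?C * \<bar>s - t\<bar>" if "s \<in> {0..1}" "t \<in> {0..1}" for s t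
    proof -
      have "4 ^ N * compl_dist n G w \<le> ?C"
        using dw(2) by simp
      then show ?thesis
        using \<gamma>(4) that by (meson abs_ge_zero mult_right_mono order_trans)
    qed
    ultimately have "edist n (j s) (j t) \<le> (2 * ?C) * \<bar>s - t\<bar>"
      unfolding j_def using \<gamma>(1) st by (intro lipschitz_join) auto
    then show ?thesis
      by simp
  qed
  moreover have "j t \<in> G \<and> ?d / 2 ^ Suc N \<le> compl_dist n G (j t)" if t: "t \<in> {0..1}" for t
  proof (cases "t \<le> 1/2")
    case True
    have "?d / 2 ^ Suc N \<le> ?d / 2"
      using d by (intro divide_left_mono) auto
    moreover have "j t = seg_point x w (2 * t)"
      using True by (simp add: j_def)
    ultimately show ?thesis
      using seg[of "2 * t"] True t by auto
  next
    case False
    have "?d / 2 ^ Suc N = (?d / 2) / 2 ^ N"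
      by simp
    also have "\<dots> \<le> compl_dist n G w / 2 ^ N"
      using dw(1) by (intro divide_right_mono) auto
    finally show ?thesis
      using False t \<gamma>(3,5) unfolding j_def by (auto intro: order_trans simp: image_subset_iff)
  qed
  moreover have "j 0 = x" "j 1 = y"
    using \<gamma>(2) by (auto simp: j_def)
  ultimately show ?case
    by (intro exI[of _ j]) auto
qed

text \<open>The path has length at most \<open>4 ^ N * d\<close> and stays at distance at least
  \<open>d / 2 ^ N\<close> from the complement, where \<open>d\<close> is the distance at
  \<open>x\<close>; the quotient is \<open>8 ^ N\<close>.\<close>

lemma quasihyperbolic_le_chain:
  assumes G: "proper_open n G" and chain: "(chain_step (1/2) n G ^^ N) x y" and x: "x \<in> G"
  shows "quasihyperbolic n G x y \<le> 8 ^ N"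
proof -
  let ?d = "compl_dist n G x"
  have d: "0 < ?d"
    using G x by (rule proper_open_dist_pos)
  obtain \<gamma> where \<gamma>: "\<gamma> 0 = x" "\<gamma> 1 = y" "\<gamma> ` {0..1} \<subseteq> G"
    "\<forall>s\<in>{0..1}. \<forall>t\<in>{0..1}. edist n (\<gamma> s) (\<gamma> t) \<le> (4 ^ N * ?d) * \<bar>s - t\<bar>"
    "\<forall>t\<in>{0..1}. ?d / 2 ^ N \<le> compl_dist n G (\<gamma> t)"
    using chain_lipschitz_path[OF G chain x] by blast
  have "quasihyperbolic n G (\<gamma> 0) (\<gamma> 1) \<le> (4 ^ N * ?d) / (?d / 2 ^ N)"
    using \<gamma> d by (intro quasihyperbolic_le_lipschitz[OF G]) auto
  also have "\<dots> = 8 ^ N"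
    using d by (simp add: field_simps flip: power_mult_distrib)
  finally show ?thesis
    using \<gamma> by simp
qed

text \<open>All points of the segment keep at least half of the smaller end distance, whence the
  factor 2. The chain bound cannot replace this, because \<open>8 ^ N\<close> does not tend to
  0.\<close>

lemma quasihyperbolic_le_segment:
  assumes G: "proper_open n G" and xy: "x \<in> G" "y \<in> G"
    and le: "edist n x y / min (compl_dist n G x) (compl_dist n G y) \<le> 1/2"
  shows "quasihyperbolic n G x y \<le> 2 * (edist n x y / min (compl_dist n G x) (compl_dist n G y))"
proof -
  let ?m = "min (compl_dist n G x) (compl_dist n G y)"
  have m: "0 < ?m"
    using proper_open_dist_pos[OF G] xy by auto
  then have e: "edist n x y \<le> ?m / 2"
    using le by (simp add: divide_le_eq)
  have seg: "edist n x (seg_point x y t) \<le> ?m / 2" if "t \<in> {0..1}" for t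
  proof -
    have "edist n x (seg_point x y t) \<le> edist n x y"
      using that by (simp add: edist_seg_point_left mult_left_le_one_le)
    then show ?thesis
      using e by linarith
  qed
  have sp: "seg_point x y t \<in> topspace (Euclidean_space n)" for t
    using proper_open_in_space[OF G] xy by (intro seg_point_in_space) auto
  have "quasihyperbolic n G (seg_point x y 0) (seg_point x y 1) \<le> edist n x y / (?m / 2)"
  proof (rule quasihyperbolic_le_lipschitz[OF G])
    show "seg_point x y ` {0..1} \<subseteq> G"
    proof (rule image_subsetI)
      fix t :: real assume "t \<in> {0..1}"
      then have "edist n x (seg_point x y t) < compl_dist n G x"
        using seg[of t] m by auto
      then show "seg_point x y t \<in> G"
        by (rule in_of_edist_less_compl_dist[OF sp])
    qed
    show "?m / 2 \<le> compl_dist n G (seg_point x y t)" if "t \<in> {0..1}" for t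
      using proper_open_dist_lipschitz[OF G, of x "seg_point x y t"] seg[OF that] by linarith
  qed (use m in \<open>auto simp: edist_seg_point\<close>)
  then show ?thesis
    by (simp add: mult.commute)
qed

section \<open>Existence of curves, and from curves to chains\<close>

lemma chain_connected:
  assumes G: "proper_open n G" and conn: "connectedin (Euclidean_space n) G" and xy: "x \<in> G" "y \<in> G"
  shows "\<exists>N. (chain_step (1/2) n G ^^ N) x y"
proof -
  let ?R = "\<lambda>a b. \<exists>N. (chain_step (1/2) n G ^^ N) a b"
  \<comment> \<open>The radius uses 1/4 < 1/3, the one-sided threshold for a half-step.\<close>
  have near: "b \<in> G \<and> ?R a b" if "a \<in> G" "b \<in> euclid_ball n a (compl_dist n G a / 4)" for a b
  proof -
    have "edist n a b < compl_dist n G a / 4"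
      using that by (simp add: euclid_ball_def)
    then have "edist n a b \<le> (1/2) / (1 + 1/2) * compl_dist n G a"
      using edist_nonneg[of n a b] by (simp del: edist_nonneg)
    then have "chain_step (1/2) n G a b"
      using that by (intro chain_step_of_edist_le[OF G]) (auto simp: euclid_ball_def)
    then show ?thesis
      using relpowp_1 by (metis chain_step_def)
  qed
  have trans: "?R a c" if "?R a b" "?R b c" for a b c
    using that relpowp_trans by metis
  have symm: "?R a b" if "?R b a" for a b
    using that chain_commute by metis
  have pos: "0 < compl_dist n G a / 4" if "a \<in> G" for a
    using proper_open_dist_pos[OF G that] by simp
  have sub: "G \<subseteq> topspace (Euclidean_space n)"
    using conn connectedin_subset_topspace by blast
  \<comment> \<open>Since every point has a ball of points one step away, both the set of points
    reachable from \<open>x\<close> and its complement in \<open>G\<close> are open; connectedness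
    leaves only \<open>A = G\<close>.\<close>
  define A where "A = {a \<in> G. ?R x a}"
  have "openin (Euclidean_space n) A"
    unfolding openin_Euclidean_space_iff
  proof (intro conjI ballI)
    fix a assume "a \<in> A"
    then show "\<exists>e>0. euclid_ball n a e \<subseteq> A"
      using near[of a] trans pos[of a] unfolding A_def
      by (intro exI[of _ "compl_dist n G a / 4"]) blast
  qed (use sub A_def in auto)
  moreover have "openin (Euclidean_space n) (G - A)"
    unfolding openin_Euclidean_space_iff
  proof (intro conjI ballI)
    fix a assume "a \<in> G - A"
    then show "\<exists>e>0. euclid_ball n a e \<subseteq> G - A"
      using near[of a] trans symm pos[of a] unfolding A_def
      by (intro exI[of _ "compl_dist n G a / 4"]) blast
  qed (use sub in auto)
  moreover have "A \<inter> G \<noteq> {}"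
  proof -
    have "(chain_step (1/2) n G ^^ 0) x x"
      by simp
    then show ?thesis
      using xy(1) unfolding A_def by blast
  qed
  moreover have "G \<subseteq> A \<union> (G - A)" "A \<inter> (G - A) \<inter> G = {}"
    by (auto simp: A_def)
  ultimately have "(G - A) \<inter> G = {}"
    using conn[unfolded connectedin, THEN conjunct2, unfolded not_ex, THEN spec, THEN spec, of A "G - A"]
    by (simp only: simp_thms)
  then show ?thesis
    using xy(2) by (auto simp: A_def)
qed

text \<open>Shows that the infimum defining \<open>quasihyperbolic\<close> is over a nonempty set;
  only then does an upper bound for it produce a curve.\<close>

lemma qh_admissible_exists:
  assumes "proper_open n G" "connectedin (Euclidean_space n) G" "x \<in> G" "y \<in> G"
  shows "\<exists>\<gamma>. qh_admissible n G x y \<gamma>"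
proof -
  obtain N where "(chain_step (1/2) n G ^^ N) x y"
    using chain_connected[OF assms] by blast
  then obtain \<gamma> where \<gamma>: "\<gamma> 0 = x" "\<gamma> 1 = y" "\<gamma> ` {0..1} \<subseteq> G"
    "\<forall>s\<in>{0..1}. \<forall>t\<in>{0..1}. edist n (\<gamma> s) (\<gamma> t) \<le> (4 ^ N * compl_dist n G x) * \<bar>s - t\<bar>"
    using chain_lipschitz_path[OF assms(1) _ assms(3)] by blast
  then show ?thesis
    using lipschitz_imp_qh_admissible[of \<gamma> G n "4 ^ N * compl_dist n G x"]
      connectedin_subset_topspace[OF assms(2)] by auto
qed

text \<open>
  Jumping along the curve by \<open>1/41\<close> of the distance to the complement uses up at least \<open>1/42\<close>
  of the integral.
\<close>

lemma chain_along_curve: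
  assumes G: "proper_open n G" and \<sigma>: "\<And>s. s \<in> {0..L} \<Longrightarrow> \<sigma> s \<in> G"
    and lip: "\<And>s t. \<lbrakk>s \<in> {0..L}; t \<in> {0..L}\<rbrakk> \<Longrightarrow> edist n (\<sigma> s) (\<sigma> t) \<le> \<bar>s - t\<bar>"
    and "a \<in> {0..L}" "integral {a..L} (\<lambda>s. 1 / compl_dist n G (\<sigma> s)) \<le> real N / 42"
  shows "(chain_step (1/40) n G ^^ Suc N) (\<sigma> a) (\<sigma> L)"
proof -
  let ?d = "\<lambda>s. compl_dist n G (\<sigma> s)" and ?f = "\<lambda>s. 1 / compl_dist n G (\<sigma> s)"
  have d_pos: "0 < ?d s" if "s \<in> {0..L}" for s
    using proper_open_dist_pos[OF G \<sigma>[OF that]] .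
  have d_lip: "\<bar>?d s - ?d t\<bar> \<le> \<bar>s - t\<bar>" if "s \<in> {0..L}" "t \<in> {0..L}" for s t
    using proper_open_dist_lipschitz[OF G, of "\<sigma> s" "\<sigma> t"] proper_open_dist_lipschitz[OF G, of "\<sigma> t" "\<sigma> s"]
      lip[OF that] edist_commute[of n "\<sigma> s" "\<sigma> t"] by linarith
  have "1-lipschitz_on {0..L} ?d"
    using d_lip by (auto simp: lipschitz_on_def dist_real_def)
  then have "continuous_on {0..L} ?d"
    by (rule lipschitz_on_continuous_on)
  then have "continuous_on {0..L} ?f"
    using d_pos by (intro continuous_on_divide continuous_on_const) force+
  then have int: "?f integrable_on {a..b}" if "0 \<le> a" "b \<le> L" for a b
    using that by (intro integrable_continuous_real) (auto intro: continuous_on_subset)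
  have nonneg: "0 \<le> integral {a..L} ?f" if "a \<in> {0..L}" for a
    using that d_pos by (intro integral_nonneg int) (auto intro: less_imp_le)
  have jump: "chain_step (1/40) n G (\<sigma> a) (\<sigma> b)"
    if "a \<in> {0..L}" "b \<in> {0..L}" "\<bar>a - b\<bar> \<le> ?d a / 41" for a b
    using that lip[of a b] \<sigma> proper_open_in_space[OF G]
    by (intro chain_step_of_edist_le[OF G]) auto
  have consume: "1 / 42 + integral {a + ?d a / 41..L} ?f \<le> integral {a..L} ?f"
    if a: "a \<in> {0..L}" "a + ?d a / 41 < L" for a
  proof -
    let ?b = "a + ?d a / 41"
    have ab: "a \<le> ?b"
      using d_pos[OF a(1)] by simp
    \<comment> \<open>Over the jump the distance grows to at most \<open>42/41 * ?d a\<close>. So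
      the integrand is at least \<open>41 / (42 * ?d a)\<close> on an interval of length
      \<open>?d a / 41\<close>.\<close>
    have "integral {a..?b} (\<lambda>_. 41 / (42 * ?d a)) \<le> integral {a..?b} ?f"
    proof (rule integral_le)
      fix s assume s: "s \<in> {a..?b}"
      then have "s \<in> {0..L}"
        using a by auto
      then have "0 < ?d s" "?d s \<le> 42 / 41 * ?d a"
        using d_pos d_lip[of s a] a s by auto
      then show "41 / (42 * ?d a) \<le> ?f s"
        using d_pos[OF a(1)] by (simp add: field_simps)
    qed (use a ab int in auto)
    moreover have "integral {a..?b} (\<lambda>_. 41 / (42 * ?d a)) = 1 / 42"
      using ab d_pos[OF a(1)] by (simp add: field_simps)
    moreover have "integral {a..?b} ?f + integral {?b..L} ?f = integral {a..L} ?f"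
      using a ab by (intro Henstock_Kurzweil_Integration.integral_combine int) auto
    ultimately show ?thesis
      by linarith
  qed
  show ?thesis
    using assms(4,5)
  proof (induction N arbitrary: a)
    \<comment> \<open>With no integral left a full jump cannot fit before \<open>L\<close>. The
      last, possibly shorter, jump accounts for the \<open>Suc\<close> in the count.\<close>
    case 0
    show ?case
    proof (cases "a + ?d a / 41 < L")
      case True
      then have "a + ?d a / 41 \<in> {0..L}"
        using 0 d_pos[OF 0(1)] by auto
      then show ?thesis
        using consume[OF 0(1) True] nonneg[of "a + ?d a / 41"] 0(2) by simp
    next
      case False
      then have "chain_step (1/40) n G (\<sigma> a) (\<sigma> L)"
        using 0 by (intro jump) auto
      then show ?thesis
        by auto
    qed
  next
    case (Suc N)
    have L: "L \<in> {0..L}"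
      using Suc.prems(1) by auto
    show ?case
    proof (cases "a + ?d a / 41 < L")
      case True
      then have b: "a + ?d a / 41 \<in> {0..L}"
        using Suc.prems(1) d_pos[OF Suc.prems(1)] by auto
      have "chain_step (1/40) n G (\<sigma> a) (\<sigma> (a + ?d a / 41))"
        using Suc.prems(1) b d_pos[OF Suc.prems(1)] by (intro jump) auto
      moreover have "(chain_step (1/40) n G ^^ Suc N) (\<sigma> (a + ?d a / 41)) (\<sigma> L)"
        using consume[OF Suc.prems(1) True] Suc.prems(2) by (intro Suc.IH b) (simp add: field_simps)
      ultimately show ?thesis
        by (rule relpowp_Suc_I2)
    next
      case False
      then have "chain_step (1/40) n G (\<sigma> a) (\<sigma> L)"
        using Suc.prems(1) L by (intro jump) auto
      then show ?thesis
        using chain_refl[OF G _ \<sigma>[OF L], of "1/40" "Suc N"] by (rule relpowp_Suc_I2) simp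
    qed
  qed
qed

text \<open>The \<open>+ 1\<close> is slack for choosing a curve whose integral is close to the
  infimum, which need not be attained; the factor 42 counts portions of size 1/42 of that
  integral.\<close>

lemma chain_of_quasihyperbolic_le:
  assumes G: "proper_open n G" "connectedin (Euclidean_space n) G" and xy: "x \<in> G" "y \<in> G"
    and M: "quasihyperbolic n G x y \<le> M"
  shows "(chain_step (1/40) n G ^^ Suc (nat \<lceil>42 * (M + 1)\<rceil>)) x y"
proof -
  have "\<exists>\<gamma>\<in>Collect (qh_admissible n G x y). line_integral n (\<lambda>z. 1 / bdry_dist n G z) \<gamma> < M + 1"
    using M qh_admissible_exists[OF G xy] line_integral_nonneg[OF G(1)]
    unfolding quasihyperbolic_eq_INF
    by (subst cINF_less_iff[symmetric]) (auto intro!: bdd_belowI[of _ 0])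
  then obtain \<gamma> where adm: "qh_admissible n G x y \<gamma>"
    and less: "line_integral n (\<lambda>z. 1 / bdry_dist n G z) \<gamma> < M + 1"
    by blast
  let ?L = "curve_length n \<gamma> 0 1" and ?\<sigma> = "arc_length_param n \<gamma>"
  have \<gamma>: "pathin (Euclidean_space n) \<gamma>" "rectifiable n \<gamma>" "\<gamma> 0 = x" "\<gamma> 1 = y"
    using adm by (auto simp: qh_admissible_def)
  have L: "0 \<le> ?L"
    using \<gamma>(2) by (intro curve_length_nonneg) auto
  have "integral {0..?L} (\<lambda>s. 1 / compl_dist n G (?\<sigma> s)) = line_integral n (\<lambda>z. 1 / bdry_dist n G z) \<gamma>"
    unfolding line_integral_def
    by (rule integral_cong) (simp add: bdry_dist_proper_open[OF G(1)] arc_length_param_in(2)[OF adm])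
  then have "integral {0..?L} (\<lambda>s. 1 / compl_dist n G (?\<sigma> s)) \<le> real (nat \<lceil>42 * (M + 1)\<rceil>) / 42"
    using less real_nat_ceiling_ge[of "42 * (M + 1)"] by simp
  then have "(chain_step (1/40) n G ^^ Suc (nat \<lceil>42 * (M + 1)\<rceil>)) (?\<sigma> 0) (?\<sigma> ?L)"
    using L arc_length_param_in(2)[OF adm] arc_length_param_lipschitz[OF \<gamma>(1,2)]
    by (intro chain_along_curve[OF G(1)]) auto
  then show ?thesis
    using arc_length_param_ends[OF \<gamma>(1,2)] \<gamma>(3,4) by simp
qed

section \<open>Great circles and control functions\<close>

text \<open>One Gram-Schmidt step, where \<open>c\<close> is the cosine of the angle. The condition
  on \<open>c\<close> excludes \<open>b = a\<close> and \<open>b = -a\<close>, for which the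
  normalising factor vanishes.\<close>

lemma unit_orthogonal_decomposition:
  fixes a b :: "nat \<Rightarrow> real"
  assumes a: "(\<Sum>i<n. (a i)\<^sup>2) = 1" and b: "(\<Sum>i<n. (b i)\<^sup>2) = 1"
    and c: "c = (\<Sum>i<n. a i * b i)" "c\<^sup>2 < 1"
  obtains e where "(\<Sum>i<n. (e i)\<^sup>2) = 1" "(\<Sum>i<n. a i * e i) = 0"
    "\<And>i. b i = c * a i + sqrt (1 - c\<^sup>2) * e i"
proof
  let ?s = "sqrt (1 - c\<^sup>2)"
  let ?e = "\<lambda>i. (b i - c * a i) / ?s"
  have s: "?s > 0" "?s\<^sup>2 = 1 - c\<^sup>2"
    using c(2) by auto
  have "(\<Sum>i<n. (b i - c * a i)\<^sup>2) = (\<Sum>i<n. (b i)\<^sup>2) - 2 * c * (\<Sum>i<n. a i * b i) + c\<^sup>2 * (\<Sum>i<n. (a i)\<^sup>2)"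
    by (simp add: power2_eq_square algebra_simps sum.distrib sum_subtractf sum_distrib_left)
  then have "(\<Sum>i<n. (b i - c * a i)\<^sup>2) = ?s\<^sup>2"
    unfolding s(2) a b c(1)[symmetric] by (simp add: power2_eq_square)
  then show "(\<Sum>i<n. (?e i)\<^sup>2) = 1"
    using s(1) by (simp add: power_divide sum_divide_distrib[symmetric])
  have "(\<Sum>i<n. a i * (b i - c * a i)) = (\<Sum>i<n. a i * b i) - c * (\<Sum>i<n. (a i)\<^sup>2)"
    by (simp add: power2_eq_square algebra_simps sum_subtractf sum_distrib_left)
  then show "(\<Sum>i<n. a i * ?e i) = 0"
    unfolding a c(1)[symmetric] by (simp add: sum_divide_distrib[symmetric])
  show "b i = c * a i + ?s * ?e i" for i
    using s(1) by simp
qed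

text \<open>Of the first two coordinates of \<open>a\<close>, one has square below 1, so that
  coordinate vector is not parallel to \<open>a\<close> and can be orthogonalised. In dimension one
  there would be no such vector.\<close>

lemma unit_orthogonal_exists:
  fixes a :: "nat \<Rightarrow> real"
  assumes "n \<ge> 2" and a: "(\<Sum>i<n. (a i)\<^sup>2) = 1" "\<And>i. i \<ge> n \<Longrightarrow> a i = 0"
  obtains e where "(\<Sum>i<n. (e i)\<^sup>2) = 1" "(\<Sum>i<n. a i * e i) = 0" "\<And>i. i \<ge> n \<Longrightarrow> e i = 0"
proof -
  have "(\<Sum>i\<in>{0, 1}. (a i)\<^sup>2) \<le> (\<Sum>i<n. (a i)\<^sup>2)"
    using assms by (intro sum_mono2) auto
  then have "(a 0)\<^sup>2 + (a 1)\<^sup>2 \<le> 1"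
    using a by simp
  then have "(a 0)\<^sup>2 < 1 \<or> (a 1)\<^sup>2 < 1"
    by linarith
  then have "\<exists>j<n. (a j)\<^sup>2 < 1"
  proof
    assume "(a 0)\<^sup>2 < 1"
    then show ?thesis
      using assms(1) by (intro exI[of _ 0]) auto
  next
    assume "(a 1)\<^sup>2 < 1"
    then show ?thesis
      using assms(1) by (intro exI[of _ 1]) auto
  qed
  then obtain j where j: "j < n" "(a j)\<^sup>2 < 1"
    by blast
  define b where "b = (\<lambda>i. if i = j then 1 else (0 :: real))"
  have "(\<Sum>i<n. (b i)\<^sup>2) = 1" "a j = (\<Sum>i<n. a i * b i)"
    using j(1) by (simp_all add: b_def if_distrib if_distribR cong: if_cong)
  then obtain e where e: "(\<Sum>i<n. (e i)\<^sup>2) = 1" "(\<Sum>i<n. a i * e i) = 0"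
    "\<And>i. b i = a j * a i + sqrt (1 - (a j)\<^sup>2) * e i"
    using unit_orthogonal_decomposition[OF a(1), of b "a j"] j(2) by blast
  have "e i = 0" if "i \<ge> n" for i
    using e(3)[of i] a(2)[OF that] that j by (simp add: b_def split: if_splits)
  with e that show ?thesis
    by blast
qed

lemma unit_angle:
  fixes a b :: "nat \<Rightarrow> real"
  assumes n: "n \<ge> 2"
    and a: "(\<Sum>i<n. (a i)\<^sup>2) = 1" "\<And>i. i \<ge> n \<Longrightarrow> a i = 0"
    and b: "(\<Sum>i<n. (b i)\<^sup>2) = 1" "\<And>i. i \<ge> n \<Longrightarrow> b i = 0"
  obtains e \<theta> where "(\<Sum>i<n. (e i)\<^sup>2) = 1" "(\<Sum>i<n. a i * e i) = 0" "\<And>i. i \<ge> n \<Longrightarrow> e i = 0"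
    "0 \<le> \<theta>" "\<theta> \<le> pi" "\<And>i. b i = cos \<theta> * a i + sin \<theta> * e i"
proof -
  define c where "c = (\<Sum>i<n. a i * b i)"
  have diff: "(\<Sum>i<n. (b i - c * a i)\<^sup>2) = 1 - c\<^sup>2"
  proof -
    have "(\<Sum>i<n. (b i - c * a i)\<^sup>2) = (\<Sum>i<n. (b i)\<^sup>2) - 2 * c * (\<Sum>i<n. a i * b i) + c\<^sup>2 * (\<Sum>i<n. (a i)\<^sup>2)"
      by (simp add: power2_eq_square algebra_simps sum.distrib sum_subtractf sum_distrib_left)
    then show ?thesis
      unfolding a b c_def[symmetric] by (simp add: power2_eq_square)
  qed
  then have "c\<^sup>2 \<le> 1"
    using sum_nonneg[of "{..<n}" "\<lambda>i. (b i - c * a i)\<^sup>2"] by simp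
  then obtain \<theta> where \<theta>: "0 \<le> \<theta>" "\<theta> \<le> pi" "c = cos \<theta>" "sqrt (1 - c\<^sup>2) = sin \<theta>"
    using sincos_total_pi[of "sqrt (1 - c\<^sup>2)" c] by auto
  show ?thesis
  proof (cases "c\<^sup>2 < 1")
    case True
    then obtain e where e: "(\<Sum>i<n. (e i)\<^sup>2) = 1" "(\<Sum>i<n. a i * e i) = 0"
      "\<And>i. b i = c * a i + sqrt (1 - c\<^sup>2) * e i"
      using unit_orthogonal_decomposition[OF a(1) b(1) c_def] by blast
    have "e i = 0" if "i \<ge> n" for i
      using e(3)[of i] a(2)[OF that] b(2)[OF that] True by simp
    then show ?thesis
      by (rule that[OF e(1,2) _ \<theta>(1,2) e(3)[unfolded \<theta>(4), unfolded \<theta>(3)]])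
  next
    \<comment> \<open>Here \<open>b\<close> is \<open>a\<close> or \<open>-a\<close> and
      \<open>sin \<theta> = 0\<close>, so any unit vector orthogonal to \<open>a\<close> will do;
      for \<open>-a\<close> it selects one of the half circles.\<close>
    case False
    then have c1: "c\<^sup>2 = 1"
      using \<open>c\<^sup>2 \<le> 1\<close> by simp
    obtain e where e: "(\<Sum>i<n. (e i)\<^sup>2) = 1" "(\<Sum>i<n. a i * e i) = 0" "\<And>i. i \<ge> n \<Longrightarrow> e i = 0"
      using unit_orthogonal_exists[OF n a] by blast
    have "(\<Sum>i<n. (b i - c * a i)\<^sup>2) = 0"
      using diff c1 by simp
    then have "b i = c * a i" if "i < n" for i
      using that by (simp add: sum_nonneg_eq_0_iff)
    moreover have "b i = c * a i" if "\<not> i < n" for i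
      using a(2)[of i] b(2)[of i] that by simp
    moreover have "sin \<theta> = 0"
      using \<theta>(4) c1 by simp
    ultimately have be: "b i = cos \<theta> * a i + sin \<theta> * e i" for i
      using \<theta>(3) by (cases "i < n") auto
    show ?thesis
      by (rule that[OF e(1,2) _ \<theta>(1,2)]) (fact e(3), fact be)
  qed
qed

lemma abs_cos_diff_le: "\<bar>cos s - cos t\<bar> \<le> \<bar>s - t :: real\<bar>"
  and abs_sin_diff_le: "\<bar>sin s - sin t\<bar> \<le> \<bar>s - t :: real\<bar>"
proof -
  have *: "2 * \<bar>x\<bar> * \<bar>sin u\<bar> \<le> 2 * \<bar>u\<bar>" if "\<bar>x\<bar> \<le> 1" for x u :: real
    using mult_mono[OF that abs_sin_x_le_abs_x[of u]] by simp
  show "\<bar>cos s - cos t\<bar> \<le> \<bar>s - t\<bar>"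
    using *[of "sin ((s + t) / 2)" "(t - s) / 2"] by (simp add: cos_diff_cos abs_mult abs_minus_commute)
  show "\<bar>sin s - sin t\<bar> \<le> \<bar>s - t\<bar>"
    using *[of "cos ((s + t) / 2)" "(s - t) / 2"] by (simp add: sin_diff_sin abs_mult mult_ac)
qed

text \<open>The direction of \<open>u\<close> is rotated into that of \<open>v\<close> at constant
  radius, so the end point misses \<open>v\<close> only radially. The speed is at most
  \<open>pi\<close> times the radius; the extra factor 2 comes from bounding a Euclidean norm by a
  sum of absolute values.\<close>

lemma great_circle:
  assumes n: "n \<ge> 2"
    and sp: "z \<in> topspace (Euclidean_space n)" "u \<in> topspace (Euclidean_space n)"
      "v \<in> topspace (Euclidean_space n)"
    and u: "0 < edist n z u" and v: "0 < edist n z v"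
  obtains P where "P 0 = u" "edist n (P 1) v = \<bar>edist n z u - edist n z v\<bar>"
    "\<And>t. P t \<in> topspace (Euclidean_space n)" "\<And>t. edist n z (P t) = edist n z u"
    "\<And>s t. edist n (P s) (P t) \<le> 2 * pi * edist n z u * \<bar>s - t\<bar>"
proof -
  let ?\<rho> = "edist n z u" and ?\<tau> = "edist n z v"
  have unit: "(\<Sum>i<n. ((w i - z i) / edist n z w)\<^sup>2) = 1" if "0 < edist n z w" for w
  proof -
    have "(edist n z w)\<^sup>2 = (\<Sum>i<n. (w i - z i)\<^sup>2)"
      by (simp add: edist_def L2_set_def sum_nonneg power2_commute)
    moreover have "(edist n z w)\<^sup>2 \<noteq> 0"
      using that by simp
    ultimately show ?thesis
      by (simp add: power_divide sum_divide_distrib[symmetric])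
  qed
  let ?a = "\<lambda>i. (u i - z i) / ?\<rho>" and ?b = "\<lambda>i. (v i - z i) / ?\<tau>"
  have supp: "?a i = 0" "?b i = 0" if "i \<ge> n" for i
    using sp that by (auto simp: topspace_Euclidean_space)
  obtain e \<theta> where e: "(\<Sum>i<n. (e i)\<^sup>2) = 1" "(\<Sum>i<n. ?a i * e i) = 0" "\<And>i. i \<ge> n \<Longrightarrow> e i = 0"
    and \<theta>: "0 \<le> \<theta>" "\<theta> \<le> pi" and b: "\<And>i. ?b i = cos \<theta> * ?a i + sin \<theta> * e i"
    using unit_angle[OF n unit[OF u] supp(1) unit[OF v] supp(2)] by blast
  define P where "P t = (\<lambda>i. z i + ?\<rho> * (cos (\<theta> * t) * ?a i + sin (\<theta> * t) * e i))" for t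
  \<comment> \<open>Pythagoras in the orthonormal frame formed by the direction of \<open>u\<close>
    and \<open>e\<close>.\<close>
  have norm: "L2_set (\<lambda>i. k * (p * ?a i + q * e i)) {..<n} = \<bar>k\<bar> * sqrt (p\<^sup>2 + q\<^sup>2)" for k p q
  proof -
    have "(\<Sum>i<n. (p * ?a i + q * e i)\<^sup>2) =
        p\<^sup>2 * (\<Sum>i<n. (?a i)\<^sup>2) + 2 * p * q * (\<Sum>i<n. ?a i * e i) + q\<^sup>2 * (\<Sum>i<n. (e i)\<^sup>2)"
      unfolding sum_distrib_left sum.distrib[symmetric]
      by (rule sum.cong) (auto simp: power2_eq_square algebra_simps)
    also have "\<dots> = p\<^sup>2 + q\<^sup>2"
      unfolding e unit[OF u] by simp
    finally show ?thesis
      by (simp add: L2_set_def power_mult_distrib sum_distrib_left[symmetric] real_sqrt_mult)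
  qed
  show ?thesis
  proof (rule that)
    show "P 0 = u"
      using u by (simp add: P_def)
    show "P t \<in> topspace (Euclidean_space n)" for t
      using sp e(3) by (simp add: topspace_Euclidean_space P_def)
    show "edist n z (P t) = ?\<rho>" for t
    proof -
      have "P t i - z i = ?\<rho> * (cos (\<theta> * t) * ?a i + sin (\<theta> * t) * e i)" for i
        by (simp add: P_def)
      then have "edist n (P t) z = ?\<rho>"
        unfolding edist_def[of n "P t"] by (simp only: norm sin_cos_squared_add2) simp
      then show ?thesis
        by (simp only: edist_commute[of n z])
    qed
    have "P 1 i - v i = (?\<rho> - ?\<tau>) * (cos \<theta> * ?a i + sin \<theta> * e i)" for i
    proof -
      have "v i = z i + ?\<tau> * ?b i"
        using v by simp
      then show ?thesis
        unfolding b by (simp only: P_def mult_1_right) (simp only: algebra_simps)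
    qed
    then show "edist n (P 1) v = \<bar>?\<rho> - ?\<tau>\<bar>"
      unfolding edist_def[of n "P 1"] by (simp only: norm sin_cos_squared_add2) simp
    show "edist n (P s) (P t) \<le> 2 * pi * ?\<rho> * \<bar>s - t\<bar>" for s t
    proof -
      let ?p = "cos (\<theta> * s) - cos (\<theta> * t)" and ?q = "sin (\<theta> * s) - sin (\<theta> * t)"
      have "P s i - P t i = ?\<rho> * (?p * ?a i + ?q * e i)" for i
        unfolding P_def by (simp only: algebra_simps)
      then have dist: "edist n (P s) (P t) = ?\<rho> * sqrt (?p\<^sup>2 + ?q\<^sup>2)"
        unfolding edist_def[of n "P s"] by (simp only: norm) simp
      have "sqrt (?p\<^sup>2 + ?q\<^sup>2) \<le> \<bar>?p\<bar> + \<bar>?q\<bar>"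
        by (rule sqrt_sum_squares_le_sum_abs)
      also have "\<dots> \<le> 2 * \<bar>\<theta> * s - \<theta> * t\<bar>"
        unfolding mult_2 by (intro add_mono abs_cos_diff_le abs_sin_diff_le)
      also have "\<dots> = 2 * (\<theta> * \<bar>s - t\<bar>)"
        using \<theta>(1) by (simp add: abs_mult flip: right_diff_distrib)
      also have "\<dots> \<le> 2 * (pi * \<bar>s - t\<bar>)"
        using \<theta>(2) by (simp add: mult_right_mono)
      finally have "?\<rho> * sqrt (?p\<^sup>2 + ?q\<^sup>2) \<le> ?\<rho> * (2 * (pi * \<bar>s - t\<bar>))"
        by (rule mult_left_mono) simp
      then show ?thesis
        unfolding dist by (simp only: mult_ac)
    qed
  qed
qed

text \<open>A half-step may be as long as \<open>3/20 * r\<close> here. With \<open>pi < 4\<close>,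
  a hundredth of the arc is at most \<open>136/1000 * r\<close>, so 100 steps go around and one
  radial step of length at most \<open>r / 10\<close> finishes.\<close>

lemma annulus_chain:
  assumes n: "n \<ge> 2" and D: "proper_open n D" and z: "z \<in> topspace (Euclidean_space n)" and r: "r > 0"
    and ann: "\<And>w. \<lbrakk>w \<in> topspace (Euclidean_space n); 13/10 * r \<le> edist n z w; edist n z w \<le> 17/10 * r\<rbrakk>
      \<Longrightarrow> w \<in> D \<and> 3/10 * r \<le> compl_dist n D w"
    and u: "u \<in> topspace (Euclidean_space n)" "13/10 * r \<le> edist n z u" "edist n z u \<le> 17/10 * r"
    and v: "v \<in> topspace (Euclidean_space n)" "13/10 * r \<le> edist n z v" "edist n z v \<le> 17/10 * r"
    and uv: "\<bar>edist n z u - edist n z v\<bar> \<le> r / 10"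
  shows "(chain_step (1/2) n D ^^ 101) u v"
proof -
  obtain P where P: "P 0 = u" "edist n (P 1) v = \<bar>edist n z u - edist n z v\<bar>"
    "\<And>t. P t \<in> topspace (Euclidean_space n)" "\<And>t. edist n z (P t) = edist n z u"
    "\<And>s t. edist n (P s) (P t) \<le> 2 * pi * edist n z u * \<bar>s - t\<bar>"
    by (rule great_circle[OF n z u(1) v(1)]) (use u v r in auto)
  have near: "chain_step (1/2) n D w w'"
    if "w \<in> D \<and> 3/10 * r \<le> compl_dist n D w" "w' \<in> D \<and> 3/10 * r \<le> compl_dist n D w'"
      "edist n w w' \<le> 3/20 * r" for w w'
    using that by (simp add: chain_step_def min_def)
  have PD: "P t \<in> D \<and> 3/10 * r \<le> compl_dist n D (P t)" for t
    using P(3,4) u by (intro ann) auto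
  have "(chain_step (1/2) n D ^^ k) u (P (real k / 100))" for k
  proof (induction k)
    case (Suc k)
    have "edist n (P (real k / 100)) (P (real (Suc k) / 100)) \<le> 2 * pi * edist n z u * \<bar>real k / 100 - real (Suc k) / 100\<bar>"
      by (rule P(5))
    also have "\<bar>real k / 100 - real (Suc k) / 100\<bar> = 1 / 100"
      by (simp add: field_simps)
    also have "2 * pi * edist n z u * (1 / 100) \<le> 2 * 4 * (17/10 * r) * (1 / 100)"
      using u(3) pi_less_4 r by (intro mult_right_mono mult_mono) auto
    also have "\<dots> \<le> 3/20 * r"
      using r by simp
    finally have "chain_step (1/2) n D (P (real k / 100)) (P (real (Suc k) / 100))"
      by (intro near PD)
    then show ?case
      using Suc by auto
  qed (simp add: P(1))
  from this[of 100] have circle: "(chain_step (1/2) n D ^^ 100) u (P 1)"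
    by simp
  have radial: "chain_step (1/2) n D (P 1) v"
    using P(2) uv r v by (intro near PD ann) auto
  show ?thesis
    using relpowp_Suc_I[OF circle, of v] radial by simp
qed

text \<open>Each excursion of the \<open>R\<close>-chain out of \<open>S\<close> is replaced by a single \<open>Q\<close>-chain inside \<open>A\<close>.\<close>

lemma relpowp_bypass:
  fixes R Q :: "'a \<Rightarrow> 'a \<Rightarrow> bool"
  assumes inside: "\<And>x y. \<lbrakk>R x y; x \<in> S; y \<in> S\<rbrakk> \<Longrightarrow> (Q ^^ m) x y"
    and detour: "\<And>x y. \<lbrakk>x \<in> A; y \<in> A\<rbrakk> \<Longrightarrow> (Q ^^ m) x y"
    and leave: "\<And>x y. \<lbrakk>R x y; x \<in> S; y \<notin> S\<rbrakk> \<Longrightarrow> x \<in> A"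
    and enter: "\<And>x y. \<lbrakk>R x y; x \<notin> S; y \<in> S\<rbrakk> \<Longrightarrow> y \<in> A"
    and chain: "(R ^^ N) x y" and xy: "x \<in> S" "y \<in> S"
  shows "(Q ^^ (m * N)) x y"
proof -
  \<comment> \<open>While the chain is outside \<open>S\<close>, the invariant is that every point
    of \<open>A\<close> has been reached already, so the point of re-entry need not be foreseen on
    leaving. Detours from a point of \<open>A\<close> to itself pad the count.\<close>
  have *: "(y \<in> S \<longrightarrow> (Q ^^ (m * N)) x y) \<and> (y \<notin> S \<longrightarrow> (\<forall>w\<in>A. (Q ^^ (m * N)) x w))"
    using chain
  proof (induction N arbitrary: y)
    case 0
    then show ?case
      using xy(1) by auto
  next
    case (Suc N)
    from Suc.prems obtain p where p: "(R ^^ N) x p" "R p y"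
      by auto
    note IH = Suc.IH[OF p(1)]
    have ext: "(Q ^^ (m * Suc N)) x c" if "(Q ^^ (m * N)) x b" "(Q ^^ m) b c" for b c
      using relpowp_trans[OF that] by (simp add: add.commute)
    show ?case
    proof (cases "p \<in> S")
      case True
      then show ?thesis
        using IH ext inside[OF p(2)] detour leave[OF p(2)] by blast
    next
      case False
      then show ?thesis
        using IH ext detour enter[OF p(2)] by blast
    qed
  qed
  then show ?thesis
    using xy(2) by blast
qed

section \<open>Control functions\<close>

lemma halfline_homeo_majorant:
  fixes \<Phi> :: "real \<Rightarrow> real"
  assumes mono: "mono_on {0..} \<Phi>" and nonneg: "\<And>t. t \<ge> 0 \<Longrightarrow> \<Phi> t \<ge> 0"
  obtains \<theta> where "halfline_homeo \<theta>" "\<And>t. t \<ge> 0 \<Longrightarrow> 2 * t \<le> \<theta> t" "\<And>t. t \<ge> 1/2 \<Longrightarrow> \<Phi> t \<le> \<theta> t"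
proof -
  define I where "I t = integral {0..t} \<Phi>" for t
  \<comment> \<open>Integration removes the jumps of \<open>\<Phi>\<close>, and the linear term
    makes the function strictly increasing with Lipschitz inverse. The upper limit
    \<open>3 * t\<close> leaves an interval of length \<open>2 * t\<close> on which
    \<open>\<Phi>\<close> is at least \<open>\<Phi> t\<close>; that length is at least 1 once
    \<open>t \<ge> 1/2\<close>.\<close>
  define \<theta> where "\<theta> t = 2 * t + I (3 * t)" for t
  have int: "\<Phi> integrable_on {a..b}" if "0 \<le> a" for a b
    by (rule integrable_on_mono_on, rule mono_on_subset[OF mono]) (use that in auto)
  have I_add: "I s + integral {s..t} \<Phi> = I t" if "0 \<le> s" "s \<le> t" for s t
    unfolding I_def using that by (intro Henstock_Kurzweil_Integration.integral_combine int) auto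
  have I_mono: "I s \<le> I t" if "0 \<le> s" "s \<le> t" for s t
    using I_add[OF that] integral_nonneg[OF int, of s t] nonneg that by force
  have I0: "I 0 = 0"
    by (simp add: I_def)
  have ge: "2 * t \<le> \<theta> t" if "0 \<le> t" for t
    using I_mono[of 0 "3 * t"] I0 that by (simp add: \<theta>_def)
  have grow: "2 * (t - s) \<le> \<theta> t - \<theta> s" if "0 \<le> s" "s \<le> t" for s t
    using I_mono[of "3 * s" "3 * t"] that by (simp add: \<theta>_def)
  have maj: "\<Phi> t \<le> \<theta> t" if t: "t \<ge> 1/2" for t
  proof -
    have "integral {t..3 * t} (\<lambda>_. \<Phi> t) \<le> integral {t..3 * t} \<Phi>"
      using t by (intro integral_le int) (auto intro: mono_onD[OF mono])
    moreover have "1 * \<Phi> t \<le> (2 * t) * \<Phi> t"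
      using t nonneg[of t] by (intro mult_right_mono) auto
    ultimately have "\<Phi> t \<le> integral {t..3 * t} \<Phi>"
      using t by (simp add: algebra_simps)
    then show ?thesis
      using I_add[of t "3 * t"] I_mono[of 0 t] I0 t by (simp add: \<theta>_def)
  qed
  have cont_Icc: "continuous_on {0..b} \<theta>" for b
  proof -
    have "continuous_on {0..3 * b} I"
      unfolding I_def by (intro indefinite_integral_continuous_1 int) simp
    then have "continuous_on {0..b} (\<lambda>t. I (3 * t))"
      by (rule continuous_on_compose2) (auto intro!: continuous_intros)
    then show ?thesis
      unfolding \<theta>_def by (intro continuous_intros)
  qed
  have cont: "continuous_on {0..} \<theta>"
    unfolding continuous_on_eq_continuous_within
  proof
    fix t :: real assume t: "t \<in> {0..}"
    have "at t within {0..} = at t within {0..t + 1}"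
      by (rule at_within_nhd[of t "{..<t + 1}"]) auto
    then show "continuous (at t within {0..}) \<theta>"
      using cont_Icc[of "t + 1"] t by (auto simp: continuous_on_eq_continuous_within continuous_within)
  qed
  define g where "g = the_inv_into {0..} \<theta>"
  have inj: "inj_on \<theta> {0..}"
  proof (rule linorder_inj_onI)
    show "\<theta> x \<noteq> \<theta> y" if "x < y" "x \<in> {0..}" "y \<in> {0..}" for x y
      using grow[of x y] that by auto
  qed auto
  have img: "\<theta> ` {0..} = {0..}"
  proof
    show "\<theta> ` {0..} \<subseteq> {0..}"
      using ge by force
    show "{0..} \<subseteq> \<theta> ` {0..}"
    proof
      fix y :: real assume "y \<in> {0..}"
      then obtain x where "0 \<le> x" "\<theta> x = y"
        using IVT'[of \<theta> 0 y y] cont_Icc[of y] ge[of y] I0 by (auto simp: \<theta>_def)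
      then show "y \<in> \<theta> ` {0..}"
        by auto
    qed
  qed
  have g: "g (\<theta> x) = x" if "0 \<le> x" for x
    using the_inv_into_f_f[OF inj, of x] that by (simp add: g_def)
  have "1-lipschitz_on {0..} g"
  proof (rule lipschitz_onI)
    fix a b :: real assume "a \<in> {0..}" "b \<in> {0..}"
    then have "a \<in> \<theta> ` {0..}" "b \<in> \<theta> ` {0..}"
      using img by auto
    then obtain x y where xy: "a = \<theta> x" "b = \<theta> y" "0 \<le> x" "0 \<le> y"
      by auto
    show "dist (g a) (g b) \<le> 1 * dist a b"
      using grow[of x y] grow[of y x] xy g by (cases "x \<le> y") (auto simp: dist_real_def)
  qed simp
  then have "continuous_on {0..} g"
    by (rule lipschitz_on_continuous_on)
  moreover have "g ` {0..} = {0..}"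
    using the_inv_into_onto[OF inj] img by (simp add: g_def)
  moreover have "\<theta> (g y) = y" if "y \<in> {0..}" for y
    using f_the_inv_into_f[OF inj, of y] img that by (simp add: g_def)
  ultimately have "homeomorphism {0..} {0..} \<theta> g"
    using g img cont by (intro homeomorphismI) auto
  then show ?thesis
    using that ge maj unfolding halfline_homeo_def by blast
qed

text \<open>A majorant that is increasing by construction, which spares a proof that
  self-homeomorphisms of the half-line are increasing.\<close>

definition sup_upto :: "(real \<Rightarrow> real) \<Rightarrow> real \<Rightarrow> real" where
  "sup_upto \<phi> t = Sup (\<phi> ` {0..t})"

lemma bdd_above_halfline_homeo:
  assumes "halfline_homeo \<phi>"
  shows "bdd_above (\<phi> ` {0..t})"
proof -
  have "continuous_on {0..} \<phi>"
    using assms by (auto simp: halfline_homeo_def homeomorphism_def)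
  then have "continuous_on {0..t} \<phi>"
    by (rule continuous_on_subset) auto
  then show ?thesis
    by (intro bounded_imp_bdd_above compact_imp_bounded compact_continuous_image) auto
qed

lemma le_sup_upto: "\<lbrakk>halfline_homeo \<phi>; 0 \<le> s; s \<le> t\<rbrakk> \<Longrightarrow> \<phi> s \<le> sup_upto \<phi> t"
  unfolding sup_upto_def by (rule cSUP_upper) (auto intro: bdd_above_halfline_homeo)

lemma sup_upto_mono: "\<lbrakk>halfline_homeo \<phi>; 0 \<le> s; s \<le> t\<rbrakk> \<Longrightarrow> sup_upto \<phi> s \<le> sup_upto \<phi> t"
  unfolding sup_upto_def by (rule cSUP_subset_mono) (auto intro: bdd_above_halfline_homeo)

section \<open>Removing a compact set\<close>

text \<open>
  The radius is normalised so that \<open>2 * r\<close> is exactly the distance from \<open>z\<close> to the complement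
  of \<open>G\<close>; the general case reduces to this one by enlarging the ball.
\<close>

locale removed_compact =
  fixes n :: nat and G E :: "(nat \<Rightarrow> real) set" and z :: "nat \<Rightarrow> real" and r :: real
  assumes n: "n \<ge> 2"
    and G: "proper_open n G" "connectedin (Euclidean_space n) G"
    and C: "proper_open n (topspace (Euclidean_space n) - E)"
      "connectedin (Euclidean_space n) (topspace (Euclidean_space n) - E)"
    and z: "z \<in> topspace (Euclidean_space n)" and r: "r > 0" and dist_z: "compl_dist n G z = 2 * r"
    and E: "E \<subseteq> euclid_ball n z r"
begin

abbreviation "X \<equiv> topspace (Euclidean_space n)"
abbreviation "D \<equiv> G - E"
abbreviation "dG \<equiv> compl_dist n G"
abbreviation "dE \<equiv> compl_dist n (X - E)"
abbreviation "dD \<equiv> compl_dist n D"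

lemma E_sub: "E \<subseteq> X"
  using E by (auto simp: euclid_ball_def)

lemma E_nonempty: "E \<noteq> {}"
  using C(1) by (auto simp: proper_open_def)

lemma D_in_space: "w \<in> D \<Longrightarrow> w \<in> X"
  using G(1) by (auto intro: proper_open_in_space)

lemma dD_eq: "dD w = min (dG w) (dE w)"
  using G(1) E_sub E_nonempty by (intro compl_dist_Diff) (auto simp: proper_open_def)

lemma proper_open_D: "proper_open n D"
proof -
  have "D = G \<inter> (X - E)"
    using proper_open_in_space[OF G(1)] by auto
  then show ?thesis
    using G(1) C(1) by (auto simp: proper_open_def)
qed

lemma dG_le: "dG w \<le> edist n z w + 2 * r"
  using proper_open_dist_lipschitz[OF G(1), of w z] dist_z edist_commute[of n w z] by linarith

lemma dG_ge: "2 * r - edist n z w \<le> dG w"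
  using proper_open_dist_lipschitz[OF G(1), of z w] dist_z by linarith

lemma dE_ge: "edist n z w - r \<le> dE w"
proof (rule compl_dist_greatest)
  fix e assume "e \<in> X - (X - E)"
  then have "edist n z e < r"
    using E by (auto simp: euclid_ball_def)
  then show "edist n z w - r \<le> edist n w e"
    using edist_triangle[of n z w e] edist_commute[of n w e] by linarith
qed (use E_sub E_nonempty in auto)

lemma dE_le: "dE w \<le> edist n z w + r"
proof -
  obtain e where e: "e \<in> E"
    using E_nonempty by blast
  then have "edist n z e < r"
    using E by (auto simp: euclid_ball_def)
  moreover have "dE w \<le> edist n w e"
    using e E_sub by (intro compl_dist_le) auto
  ultimately show ?thesis
    using edist_triangle[of n w e z] edist_commute[of n w z] by linarith
qed

lemma in_G: "\<lbrakk>w \<in> X; edist n z w < 2 * r\<rbrakk> \<Longrightarrow> w \<in> G"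
  using dist_z by (intro in_of_edist_less_compl_dist[of w n z G]) auto

lemma not_in_E: "r \<le> edist n z w \<Longrightarrow> w \<notin> E"
  using E by (auto simp: euclid_ball_def)

text \<open>The margins \<open>17/10 * r\<close> to \<open>2 * r\<close> and \<open>r\<close> to
  \<open>13/10 * r\<close> both have width \<open>3/10 * r\<close>; they bound the distances to the
  complement of \<open>G\<close> and to \<open>E\<close>.\<close>

lemma annulus:
  assumes "w \<in> X" "13/10 * r \<le> edist n z w" "edist n z w \<le> 17/10 * r"
  shows "w \<in> D \<and> 3/10 * r \<le> dD w"
  using in_G[OF assms(1)] not_in_E[of w] dG_ge[of w] dE_ge[of w] assms r by (auto simp: dD_eq)

lemma annulus_joined:
  assumes "13/10 * r \<le> c" "c + r / 10 \<le> 17/10 * r"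
    and u: "u \<in> X" "c \<le> edist n z u" "edist n z u \<le> c + r / 10"
    and v: "v \<in> X" "c \<le> edist n z v" "edist n z v \<le> c + r / 10"
  shows "(chain_step (1/2) n D ^^ 101) u v"
  using assms by (intro annulus_chain[OF n proper_open_D z r annulus]) linarith+

text \<open>An ordinary step is padded to 101 because \<open>relpowp_bypass\<close> uses one count
  for ordinary steps and detours.\<close>

lemma chain_step_D:
  assumes "x \<in> D" "y \<in> D" "edist n x y \<le> 1/2 * min (dD x) (dD y)"
  shows "(chain_step (1/2) n D ^^ 101) x y"
  by (rule chain_mono[OF proper_open_D, of _ 1])
    (use assms in \<open>auto simp: chain_step_def\<close>)

text \<open>
  The step size \<open>1/40\<close> is small enough both for a step across the sphere to start or end in an
  annulus of width \<open>r/10\<close> and to absorb the comparison constants \<open>16\<close> and \<open>14\<close>.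
\<close>

lemma outer_chain:
  assumes "(chain_step (1/40) n G ^^ N) x y"
    and "x \<in> X" "13/10 * r \<le> edist n z x" "y \<in> X" "13/10 * r \<le> edist n z y"
  shows "(chain_step (1/2) n D ^^ (101 * N)) x y"
proof (rule relpowp_bypass[where R = "chain_step (1/40) n G" and S = "{w \<in> X. 13/10 * r \<le> edist n z w}"
      and A = "{w \<in> X. 13/10 * r \<le> edist n z w \<and> edist n z w \<le> 14/10 * r}"])
  \<comment> \<open>The inner end \<open>v\<close> has \<open>dG v \<le> 33/10 * r\<close>, so the
    step is shorter than \<open>r / 10\<close>.\<close>
  have cross: "edist n z u \<le> 14/10 * r"
    if "chain_step (1/40) n G u v" "edist n z v < 13/10 * r" for u v
  proof -
    have "edist n u v \<le> 1/40 * dG v"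
      using that(1) by (auto simp: chain_step_def)
    then show ?thesis
      using dG_le[of v] that(2) edist_triangle[of n z u v] edist_commute[of n u v] r by linarith
  qed
  fix u v assume step: "chain_step (1/40) n G u v"
  then have uv: "u \<in> X" "v \<in> X" "u \<in> G" "v \<in> G" "edist n u v \<le> 1/40 * min (dG u) (dG v)"
    using proper_open_in_space[OF G(1)] by (auto simp: chain_step_def)
  {
    assume "u \<in> {w \<in> X. 13/10 * r \<le> edist n z w}" "v \<in> {w \<in> X. 13/10 * r \<le> edist n z w}"
    then have far: "13/10 * r \<le> edist n z u" "13/10 * r \<le> edist n z v"
      by auto
    \<comment> \<open>If \<open>dE\<close> is the smaller distance, compare
      \<open>\<rho> + 2 * r\<close> with \<open>\<rho> - r\<close> for the distance
      \<open>\<rho> \<ge> 13/10 * r\<close> to \<open>z\<close>; the ratio is at most 11. Any factor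
      up to 20 turns a step of size 1/40 into a half-step.\<close>
    have "dG w \<le> 16 * dD w" if "13/10 * r \<le> edist n z w" "w \<in> G" for w
      using dG_le[of w] dE_ge[of w] that r proper_open_dist_pos[OF G(1), of w] unfolding dD_eq min_def
      by (auto split: if_splits)
    then have "dG u \<le> 16 * dD u" "dG v \<le> 16 * dD v"
      using far uv by auto
    moreover have "edist n u v \<le> dG u / 40" "edist n u v \<le> dG v / 40"
      using uv(5) by auto
    ultimately have "edist n u v \<le> dD u / 2" "edist n u v \<le> dD v / 2"
      using edist_nonneg[of n u v] by linarith+
    then have "edist n u v \<le> 1/2 * min (dD u) (dD v)"
      by (simp add: min_def)
    then show "(chain_step (1/2) n D ^^ 101) u v"
      using uv far not_in_E[of u] not_in_E[of v] r by (intro chain_step_D) auto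
  next
    assume "u \<in> {w \<in> X. 13/10 * r \<le> edist n z w}" "v \<notin> {w \<in> X. 13/10 * r \<le> edist n z w}"
    then show "u \<in> {w \<in> X. 13/10 * r \<le> edist n z w \<and> edist n z w \<le> 14/10 * r}"
      using cross[OF step] uv by auto
  next
    assume "u \<notin> {w \<in> X. 13/10 * r \<le> edist n z w}" "v \<in> {w \<in> X. 13/10 * r \<le> edist n z w}"
    then show "v \<in> {w \<in> X. 13/10 * r \<le> edist n z w \<and> edist n z w \<le> 14/10 * r}"
      using cross[OF step[unfolded chain_step_commute[of _ _ _ u v]]] uv by auto
  }
qed (use assms r in \<open>auto intro!: annulus_joined[of "13/10 * r"]\<close>)

text \<open>Mirror image of \<open>outer_chain\<close>: excursions now go outwards, so the annulus
  for detours lies just inside the outer radius \<open>17/10 * r\<close>.\<close>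

lemma inner_chain:
  assumes "(chain_step (1/40) n (X - E) ^^ N) x y"
    and "x \<in> X" "edist n z x \<le> 17/10 * r" "y \<in> X" "edist n z y \<le> 17/10 * r"
  shows "(chain_step (1/2) n D ^^ (101 * N)) x y"
proof (rule relpowp_bypass[where R = "chain_step (1/40) n (X - E)" and S = "{w \<in> X. edist n z w \<le> 17/10 * r}"
      and A = "{w \<in> X. 16/10 * r \<le> edist n z w \<and> edist n z w \<le> 17/10 * r}"])
  have cross: "16/10 * r \<le> edist n z u"
    if "chain_step (1/40) n (X - E) u v" "edist n z u \<le> 17/10 * r" "17/10 * r < edist n z v" for u v
  proof -
    have "edist n u v \<le> 1/40 * dE u"
      using that(1) by (auto simp: chain_step_def)
    then show ?thesis
      using dE_le[of u] that(2,3) edist_triangle[of n z v u] r by linarith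
  qed
  fix u v assume step: "chain_step (1/40) n (X - E) u v"
  then have uv: "u \<in> X" "v \<in> X" "u \<notin> E" "v \<notin> E" "edist n u v \<le> 1/40 * min (dE u) (dE v)"
    by (auto simp: chain_step_def)
  {
    assume "u \<in> {w \<in> X. edist n z w \<le> 17/10 * r}" "v \<in> {w \<in> X. edist n z w \<le> 17/10 * r}"
    then have near: "edist n z u \<le> 17/10 * r" "edist n z v \<le> 17/10 * r"
      by auto
    \<comment> \<open>Inside \<open>17/10 * r\<close> one has \<open>dE w \<le> 27/10 * r\<close>
      and \<open>dG w \<ge> 3/10 * r\<close>, so already 9 would do.\<close>
    have "dE w \<le> 14 * dD w" if "edist n z w \<le> 17/10 * r" "w \<in> X" "w \<notin> E" for w
      using dE_le[of w] dG_ge[of w] that r proper_open_dist_pos[OF C(1), of w] unfolding dD_eq min_def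
      by (auto split: if_splits)
    then have "dE u \<le> 14 * dD u" "dE v \<le> 14 * dD v"
      using near uv by auto
    moreover have "edist n u v \<le> dE u / 40" "edist n u v \<le> dE v / 40"
      using uv(5) by auto
    ultimately have "edist n u v \<le> dD u / 2" "edist n u v \<le> dD v / 2"
      using edist_nonneg[of n u v] by linarith+
    then have "edist n u v \<le> 1/2 * min (dD u) (dD v)"
      by (simp add: min_def)
    then show "(chain_step (1/2) n D ^^ 101) u v"
      using uv near in_G[of u] in_G[of v] r by (intro chain_step_D) auto
  next
    assume "u \<in> {w \<in> X. edist n z w \<le> 17/10 * r}" "v \<notin> {w \<in> X. edist n z w \<le> 17/10 * r}"
    then show "u \<in> {w \<in> X. 16/10 * r \<le> edist n z w \<and> edist n z w \<le> 17/10 * r}"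
      using cross[OF step] uv by auto
  next
    assume "u \<notin> {w \<in> X. edist n z w \<le> 17/10 * r}" "v \<in> {w \<in> X. edist n z w \<le> 17/10 * r}"
    then show "v \<in> {w \<in> X. 16/10 * r \<le> edist n z w \<and> edist n z w \<le> 17/10 * r}"
      using cross[OF step[unfolded chain_step_commute[of _ _ _ u v]]] uv by auto
  }
qed (use assms r in \<open>auto intro!: annulus_joined[of "16/10 * r"]\<close>)

lemma middle_point:
  obtains a where "a \<in> X" "edist n z a = 15/10 * r"
proof
  let ?a = "\<lambda>i. if i = 0 then z 0 + 15/10 * r else z i"
  show "?a \<in> X"
    using z n by (auto simp: topspace_Euclidean_space)
  have "edist n z ?a = sqrt (\<Sum>i<n. if i = 0 then (15/10 * r)\<^sup>2 else 0)"
    unfolding edist_def L2_set_def by (intro arg_cong[where f = sqrt] sum.cong) auto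
  also have "\<dots> = 15/10 * r"
    using n r by simp
  finally show "edist n z ?a = 15/10 * r" .
qed

definition rel_dist :: "(nat \<Rightarrow> real) \<Rightarrow> (nat \<Rightarrow> real) \<Rightarrow> real" where
  "rel_dist x y = edist n x y / min (dD x) (dD y)"

lemma rel_dist_commute: "rel_dist x y = rel_dist y x"
  by (simp add: rel_dist_def edist_commute min.commute)

lemma rel_dist_nonneg: "\<lbrakk>x \<in> D; y \<in> D\<rbrakk> \<Longrightarrow> 0 \<le> rel_dist x y"
  using proper_open_dist_pos[OF proper_open_D] by (auto simp: rel_dist_def min_def less_imp_le)

text \<open>Used with \<open>U\<close> equal to \<open>G\<close> and to the complement of
  \<open>E\<close>: bounds relative to \<open>G - E\<close> can be fed to both uniformity
  hypotheses.\<close>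

lemma rel_dist_dominates:
  assumes "x \<in> D" "y \<in> D" "x \<in> U" "y \<in> U" "dD x \<le> compl_dist n U x" "dD y \<le> compl_dist n U y"
  shows "edist n x y / min (compl_dist n U x) (compl_dist n U y) \<le> rel_dist x y"
proof -
  have "0 < min (dD x) (dD y)"
    using proper_open_dist_pos[OF proper_open_D] assms by auto
  moreover have "min (dD x) (dD y) \<le> min (compl_dist n U x) (compl_dist n U y)"
    using assms by (intro min.mono)
  ultimately show ?thesis
    unfolding rel_dist_def by (intro divide_left_mono mult_pos_pos) auto
qed

end

text \<open>The steps extracted from a quasihyperbolic bound, each replaced by 101 steps in
  \<open>G - E\<close>. Neither the dimension nor the domains enter.\<close>

definition chain_count :: "(real \<Rightarrow> real) \<Rightarrow> real \<Rightarrow> nat" where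
  "chain_count \<phi> t = 101 * Suc (nat \<lceil>42 * (sup_upto \<phi> t + 1)\<rceil>)"

lemma chain_count_mono: "\<lbrakk>halfline_homeo \<phi>; 0 \<le> s; s \<le> t\<rbrakk> \<Longrightarrow> chain_count \<phi> s \<le> chain_count \<phi> t"
  unfolding chain_count_def using sup_upto_mono[of \<phi> s t]
  by (intro mult_le_mono2 Suc_le_mono[THEN iffD2] nat_mono ceiling_mono) auto

lemma uniform_domain_quasihyperbolic_le:
  assumes "uniform_domain n \<phi> G" "proper_open n G" "halfline_homeo \<phi>" "x \<in> G" "y \<in> G"
    and "edist n x y / min (compl_dist n G x) (compl_dist n G y) \<le> t"
  shows "quasihyperbolic n G x y \<le> sup_upto \<phi> t"
proof -
  have "quasihyperbolic n G x y \<le> \<phi> (edist n x y / min (compl_dist n G x) (compl_dist n G y))"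
    using assms by (simp add: uniform_domain_def bdry_dist_proper_open)
  also have "\<dots> \<le> sup_upto \<phi> t"
    using assms proper_open_dist_pos[OF assms(2)] by (intro le_sup_upto) (auto simp: min_def less_imp_le)
  finally show ?thesis .
qed

locale removed_compact_uniform = removed_compact +
  fixes \<phi> \<psi> :: "real \<Rightarrow> real"
  assumes homeo: "halfline_homeo \<phi>" "halfline_homeo \<psi>"
    and uniform: "uniform_domain n \<phi> G" "uniform_domain n \<psi> (topspace (Euclidean_space n) - E)"
begin

lemma outer_count:
  assumes "x \<in> D" "y \<in> D" "13/10 * r \<le> edist n z x" "13/10 * r \<le> edist n z y" "rel_dist x y \<le> t"
  shows "(chain_step (1/2) n D ^^ chain_count \<phi> t) x y"
proof -
  have "quasihyperbolic n G x y \<le> sup_upto \<phi> t"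
    using assms rel_dist_dominates[of x y G]
    by (intro uniform_domain_quasihyperbolic_le uniform G homeo) (auto simp: dD_eq)
  then have "(chain_step (1/40) n G ^^ Suc (nat \<lceil>42 * (sup_upto \<phi> t + 1)\<rceil>)) x y"
    using assms by (intro chain_of_quasihyperbolic_le G) auto
  then show ?thesis
    unfolding chain_count_def using assms D_in_space by (intro outer_chain) auto
qed

lemma inner_count:
  assumes "x \<in> D" "y \<in> D" "edist n z x \<le> 17/10 * r" "edist n z y \<le> 17/10 * r" "rel_dist x y \<le> t"
  shows "(chain_step (1/2) n D ^^ chain_count \<psi> t) x y"
proof -
  have xy: "x \<in> X - E" "y \<in> X - E"
    using assms D_in_space by auto
  have "quasihyperbolic n (X - E) x y \<le> sup_upto \<psi> t"
    using assms xy rel_dist_dominates[of x y "X - E"]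
    by (intro uniform_domain_quasihyperbolic_le uniform C homeo) (auto simp: dD_eq)
  then have "(chain_step (1/40) n (X - E) ^^ Suc (nat \<lceil>42 * (sup_upto \<psi> t + 1)\<rceil>)) x y"
    by (intro chain_of_quasihyperbolic_le C xy)
  then show ?thesis
    unfolding chain_count_def using assms xy by (intro inner_chain) auto
qed

text \<open>The chain passes through a point \<open>a\<close> in the middle of the annulus, where
  both \<open>inner_count\<close> and \<open>outer_count\<close> apply. The factor 55 is
  \<open>11 * 5\<close>: 11 compares the separations, 5 the distances to the complement, as
  \<open>dD x \<le> 23/10 * r\<close> while \<open>dD a \<ge> 5/10 * r\<close>.\<close>

lemma mixed_count:
  assumes xy: "x \<in> D" "y \<in> D" and x: "edist n z x < 13/10 * r" and y: "17/10 * r < edist n z y"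
  shows "(chain_step (1/2) n D ^^ (chain_count \<psi> (55 * rel_dist x y) + chain_count \<phi> (55 * rel_dist x y))) x y"
proof -
  obtain a where a: "a \<in> X" "edist n z a = 15/10 * r"
    by (rule middle_point)
  have aD: "a \<in> D" "3/10 * r \<le> dD a"
    using annulus[of a] a r by auto
  have pos: "0 < dD x" "0 < dD y" "0 < dD a"
    using proper_open_dist_pos[OF proper_open_D] xy aD by auto
  have dx: "dD x \<le> 23/10 * r"
    using dE_le[of x] x by (auto simp: dD_eq min_def)
  have da: "5/10 * r \<le> dD a"
    using dG_ge[of a] dE_ge[of a] a by (auto simp: dD_eq)
  have gap: "4/10 * r \<le> edist n x y"
    using edist_triangle[of n z y x] x y by linarith
  \<comment> \<open>\<open>x\<close> and \<open>a\<close> are at most \<open>28/10 * r\<close>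
    apart, while \<open>x\<close> and \<open>y\<close> are at least \<open>4/10 * r\<close>
    apart.\<close>
  have xa: "edist n x a \<le> 10 * edist n x y"
    using edist_triangle[of n x a z] edist_commute[of n x z] a x gap r by linarith
  have ay: "edist n a y \<le> 11 * edist n x y"
    using edist_triangle[of n a y x] edist_commute[of n a x] xa by linarith
  have rel: "rel_dist u v \<le> 55 * rel_dist x y"
    if "edist n u v \<le> 11 * edist n x y" "min (dD x) (dD y) \<le> 5 * min (dD u) (dD v)" "0 < min (dD u) (dD v)" for u v
  proof -
    let ?m = "min (dD x) (dD y)"
    have "0 < ?m"
      using pos by simp
    have "rel_dist u v \<le> (11 * edist n x y) / (?m / 5)"
      unfolding rel_dist_def using that \<open>0 < ?m\<close> by (intro frac_le) auto
    also have "\<dots> = 55 * rel_dist x y"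
      by (simp add: rel_dist_def)
    finally show ?thesis .
  qed
  have "edist n x a \<le> 11 * edist n x y"
    using xa edist_nonneg[of n x y] by linarith
  then have "rel_dist x a \<le> 55 * rel_dist x y"
    using dx da pos r by (intro rel) (auto simp: min_def)
  then have "(chain_step (1/2) n D ^^ chain_count \<psi> (55 * rel_dist x y)) x a"
    using xy aD a x r by (intro inner_count) auto
  moreover have "rel_dist a y \<le> 55 * rel_dist x y"
    using ay dx da pos r by (intro rel) (auto simp: min_def)
  then have "(chain_step (1/2) n D ^^ chain_count \<phi> (55 * rel_dist x y)) a y"
    using xy aD a y r by (intro outer_count) auto
  ultimately show ?thesis
    by (rule relpowp_trans)
qed

lemma chain_in_D:
  assumes xy: "x \<in> D" "y \<in> D"
  shows "(chain_step (1/2) n D ^^ (chain_count \<psi> (55 * rel_dist x y) + chain_count \<phi> (55 * rel_dist x y))) x y"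
    (is "(_ ^^ ?N) x y")
proof -
  let ?t = "rel_dist x y"
  have t: "0 \<le> ?t" "?t \<le> 55 * ?t"
    using rel_dist_nonneg[OF xy] by auto
  \<comment> \<open>The two regions overlap in the annulus, so only pairs separated by the whole
    annulus remain. In each case the sum of both counts suffices, by padding.\<close>
  consider "13/10 * r \<le> edist n z x" "13/10 * r \<le> edist n z y"
    | "edist n z x \<le> 17/10 * r" "edist n z y \<le> 17/10 * r"
    | "edist n z x < 13/10 * r" "17/10 * r < edist n z y"
    | "edist n z y < 13/10 * r" "17/10 * r < edist n z x"
    using r by linarith
  then show ?thesis
  proof cases
    case 1
    then show ?thesis
      using outer_count[OF xy 1 t(2)] xy by (rule_tac chain_mono[OF proper_open_D]) auto
  next
    case 2
    then show ?thesis
      using inner_count[OF xy 2 t(2)] xy by (rule_tac chain_mono[OF proper_open_D]) auto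
  next
    case 3
    then show ?thesis
      by (rule mixed_count[OF xy])
  next
    case 4
    then have "(chain_step (1/2) n D ^^ ?N) y x"
      using mixed_count[OF xy(2,1)] by (simp only: rel_dist_commute[of y x])
    then show ?thesis
      by (rule chain_commute)
  qed
qed

text \<open>Chains in \<open>D\<close> exist between any two points and span paths in
  \<open>D\<close>; neither fact presupposes connectedness of \<open>D\<close>.\<close>

lemma connectedin_D: "connectedin (Euclidean_space n) D"
proof (rule path_connectedin_imp_connectedin, unfold path_connectedin, intro conjI ballI)
  show "D \<subseteq> X"
    using D_in_space by blast
  fix x y assume xy: "x \<in> D" "y \<in> D"
  then obtain \<gamma> C where \<gamma>: "\<gamma> 0 = x" "\<gamma> 1 = y" "\<gamma> ` {0..1} \<subseteq> D"
    "\<forall>s\<in>{0..1}. \<forall>t\<in>{0..1}. edist n (\<gamma> s) (\<gamma> t) \<le> C * \<bar>s - t\<bar>"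
    using chain_lipschitz_path[OF proper_open_D chain_in_D[OF xy]] by blast
  then have "qh_admissible n D x y \<gamma>"
    using lipschitz_imp_qh_admissible[of \<gamma> D n C] D_in_space by blast
  then show "\<exists>g. pathin (Euclidean_space n) g \<and> g \<in> {0..1} \<rightarrow> D \<and> g 0 = x \<and> g 1 = y"
    unfolding qh_admissible_def by blast
qed

lemma uniform_domain_D:
  assumes small: "\<And>t. 0 \<le> t \<Longrightarrow> 2 * t \<le> \<theta> t"
    and large: "\<And>t. 1/2 \<le> t \<Longrightarrow> 8 ^ (chain_count \<psi> (55 * t) + chain_count \<phi> (55 * t)) \<le> \<theta> t"
  shows "uniform_domain n \<theta> D"
proof -
  have "quasihyperbolic n D x y \<le> \<theta> (edist n x y / min (bdry_dist n D x) (bdry_dist n D y))"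
    if xy: "x \<in> D" "y \<in> D" for x y
  proof -
    have "quasihyperbolic n D x y \<le> \<theta> (rel_dist x y)"
    proof (cases "rel_dist x y \<le> 1/2")
      case True
      then have "quasihyperbolic n D x y \<le> 2 * rel_dist x y"
        unfolding rel_dist_def by (rule quasihyperbolic_le_segment[OF proper_open_D xy])
      then show ?thesis
        using small[OF rel_dist_nonneg[OF xy]] by linarith
    next
      case False
      have "quasihyperbolic n D x y \<le> 8 ^ (chain_count \<psi> (55 * rel_dist x y) + chain_count \<phi> (55 * rel_dist x y))"
        using chain_in_D[OF xy] xy(1) by (rule quasihyperbolic_le_chain[OF proper_open_D])
      then show ?thesis
        using large[of "rel_dist x y"] False by linarith
    qed
    then show ?thesis
      using xy by (simp add: rel_dist_def bdry_dist_proper_open[OF proper_open_D])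
  qed
  moreover obtain a where "a \<in> X" "edist n z a = 15/10 * r"
    by (rule middle_point)
  then have "a \<in> D"
    using annulus[of a] r by auto
  ultimately show ?thesis
    using proper_open_D connectedin_D by (auto simp: uniform_domain_def edomain_def proper_open_def)
qed

end

theorem mainTheorem1:
  fixes \<phi> \<psi> :: "real \<Rightarrow> real"
  assumes "halfline_homeo \<phi>" and "halfline_homeo \<psi>"
  shows "\<exists>\<theta>. halfline_homeo \<theta> \<and>
    (\<forall>n\<ge>2. \<forall>G E z r.
       uniform_domain n \<phi> G \<longrightarrow>
       z \<in> topspace (Euclidean_space n) \<longrightarrow> r > 0 \<longrightarrow> euclid_ball n z (2 * r) \<subseteq> G \<longrightarrow>
       compactin (Euclidean_space n) E \<longrightarrow> E \<subseteq> euclid_ball n z r \<longrightarrow>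
       uniform_domain n \<psi> (topspace (Euclidean_space n) - E) \<longrightarrow>
       uniform_domain n \<theta> (G - E))"
proof -
  \<comment> \<open>Fixed before \<open>n\<close>, \<open>G\<close>, \<open>E\<close> and the ball
    are introduced, so the control function obtained from it depends on \<open>\<phi>\<close> and
    \<open>\<psi>\<close> only.\<close>
  define \<Phi> :: "real \<Rightarrow> real"
    where "\<Phi> t = 8 ^ (chain_count \<psi> (55 * t) + chain_count \<phi> (55 * t))" for t
  have "mono_on {0..} \<Phi>"
    unfolding \<Phi>_def using assms
    by (intro mono_onI power_increasing add_mono chain_count_mono) auto
  then obtain \<theta> where \<theta>: "halfline_homeo \<theta>" "\<And>t. t \<ge> 0 \<Longrightarrow> 2 * t \<le> \<theta> t" "\<And>t. t \<ge> 1/2 \<Longrightarrow> \<Phi> t \<le> \<theta> t"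
    by (rule halfline_homeo_majorant) (auto simp: \<Phi>_def)
  have "uniform_domain n \<theta> (G - E)"
    if n: "n \<ge> 2" and G: "uniform_domain n \<phi> G"
      and z: "z \<in> topspace (Euclidean_space n)" and r: "r > 0" "euclid_ball n z (2 * r) \<subseteq> G"
      and E: "E \<subseteq> euclid_ball n z r"
      and C: "uniform_domain n \<psi> (topspace (Euclidean_space n) - E)" for n G E z and r :: real
  proof -
    have proper: "proper_open n U" "connectedin (Euclidean_space n) U" if "uniform_domain n \<eta> U" for \<eta> U
      using that openin_subset by (auto simp: uniform_domain_def edomain_def proper_open_def)
    define R where "R = compl_dist n G z / 2"
    have "2 * r \<le> compl_dist n G z"
      using proper(1)[OF G] r by (intro compl_dist_greatest) (force simp: euclid_ball_def proper_open_def)+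
    then have R: "r \<le> R"
      by (simp add: R_def)
    interpret removed_compact_uniform n G E z R \<phi> \<psi>
      using n z r R E G C assms proper[OF G] proper[OF C]
      by unfold_locales (auto simp: R_def euclid_ball_def)
    show ?thesis
      using \<theta>(2,3) unfolding \<Phi>_def by (rule uniform_domain_D)
  qed
  then show ?thesis
    using \<theta>(1) by blast
qed

end
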